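(* Assume (H1)–(H4) and (U) (for given $x_0$, $r$, $\theta$). Let $u\in C(\mathbb{R}^n\times[0,T))$ be a viscosity solution of (1.1)–(1.2). Then: (i) if $(C_1,K_3)\ne(0,0)$, $|p|\ge\theta e^{-(C_1+K_3)t}-\frac{C_1\beta}{C_1+K_3}(1-e^{-(C_1+K_3)t})$ for all $(x,t)\in\mathcal{E}(x_0,r)$ and $p\in D_x^-u(x,t)$; (ii) if $(C_1,K_3)=(0,0)$, $|p|\ge\theta$ for all $(x,t)\in\mathcal{E}(x_0,r)$ and $p\in D_x^-u(x,t)$.
   Context: Let $T>0$, $n\ge1$. $H:\mathbb{R}^n\times[0,T]\times\mathbb{R}\times\mathbb{R}^n\to\mathbb{R}$ continuous, $u_0$ Lipschitz. Problem (1.1)–(1.2): $u_t+H(x,t,u,D_xu)=0$ in $\mathbb{R}^n\times(0,T)$, $u(x,0)=u_0(x)$. (H1) there exist $C_1\ge0$, $\beta\in\{0,1\}$ with $|H(x,t,u,p)-H(y,t,u,p)|\le C_1(\beta+|p|)|x-y|$. (H2) there exist $A_2,B_2\ge0$ with $|H(x,t,u,p)-H(x,t,u,q)|\le(A_2|x|+B_2)|p-q|$. (H3) there exists $K_3\ge0$ with $|H(x,t,u,p)-H(x,t,v,p)|\le K_3|u-v|$. (H4) $p\mapsto H(x,t,u,p)$ convex. (U) for the given $x_0$, $r>0$ there is $\theta>0$ with $|p|\ge\theta$ for all $x\in B_r(x_0)$, $p\in D^-u_0(x)$. Viscosity solution: $u\in C(\mathbb{R}^n\times[0,T))$, $u(\cdot,0)=u_0$,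 and for every $\phi\in C^1(\mathbb{R}^n\times(0,T))$, if $u-\phi$ has a local max (resp. min) at $(x,t)\in\mathbb{R}^n\times(0,T)$ then $\phi_t+H(x,t,u(x,t),D_x\phi(x,t))\le0$ (resp. $\ge0$). $D^-f(x)=\{D\phi(x):\phi\in C^1,\ f-\phi$ has a local min at $x\}$; $D_x^-u(x,t)=\{p:(p,\tau)\in D^-u(x,t)\}$. $R(x,t)=(\frac{B_2}{A_2}+|x|)(e^{A_2t}-1)$ if $A_2>0$, $=B_2t$ if $A_2=0$; $\mathcal{E}(x_0,r)=\{(x,t)\in B_r(x_0)\times(0,T):R(x,t)+|x-x_0|<r\}$. *)

theory Defs
  imports "HOL-Analysis.Analysis"
begin

definition C1_on :: "'a::euclidean_space set \<Rightarrow> ('a \<Rightarrow> real) \<Rightarrow> ('a \<Rightarrow> 'a) \<Rightarrow> bool" where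
  "C1_on S \<phi> g \<longleftrightarrow> (\<forall>z\<in>S. (\<phi> has_derivative (\<lambda>h. g z \<bullet> h)) (at z)) \<and> continuous_on S g"

definition subdiff :: "'a::euclidean_space set \<Rightarrow> ('a \<Rightarrow> real) \<Rightarrow> 'a \<Rightarrow> 'a set" where
  "subdiff S f z = {g z | \<phi> g. C1_on S \<phi> g \<and>
      (\<exists>e>0. \<forall>y\<in>S. dist y z < e \<longrightarrow> f z - \<phi> z \<le> f y - \<phi> y)}"

definition subdiff_x :: "real \<Rightarrow> (real^'n::finite \<Rightarrow> real \<Rightarrow> real) \<Rightarrow> real^'n \<Rightarrow> real \<Rightarrow> (real^'n) set" where
  "subdiff_x T u x t = {p. \<exists>\<tau>. (p, \<tau>) \<in> subdiff (UNIV \<times> {0<..<T}) (\<lambda>(y, s). u y s) (x, t)}"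

definition visc_solution ::
  "real \<Rightarrow> (real^'n \<Rightarrow> real \<Rightarrow> real \<Rightarrow> real^'n \<Rightarrow> real) \<Rightarrow> (real^'n \<Rightarrow> real)
     \<Rightarrow> (real^'n \<Rightarrow> real \<Rightarrow> real) \<Rightarrow> bool" where
  "visc_solution T H u0 u \<longleftrightarrow>
     continuous_on (UNIV \<times> {0..<T}) (\<lambda>(x, t). u x t) \<and>
     (\<forall>x. u x 0 = u0 x) \<and>
     (\<forall>\<phi> g x t. C1_on (UNIV \<times> {0<..<T}) \<phi> g \<and> 0 < t \<and> t < T \<longrightarrow>
        ((\<exists>e>0. \<forall>y s. 0 < s \<and> s < T \<and> dist (y, s) (x, t) < e \<longrightarrow>
             u y s - \<phi> (y, s) \<le> u x t - \<phi> (x, t))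
           \<longrightarrow> snd (g (x, t)) + H x t (u x t) (fst (g (x, t))) \<le> 0) \<and>
        ((\<exists>e>0. \<forall>y s. 0 < s \<and> s < T \<and> dist (y, s) (x, t) < e \<longrightarrow>
             u x t - \<phi> (x, t) \<le> u y s - \<phi> (y, s))
           \<longrightarrow> snd (g (x, t)) + H x t (u x t) (fst (g (x, t))) \<ge> 0))"

definition Rfun :: "real \<Rightarrow> real \<Rightarrow> real^'n \<Rightarrow> real \<Rightarrow> real" where
  "Rfun A2 B2 x t = (if A2 > 0 then (B2 / A2 + norm x) * (exp (A2 * t) - 1) else B2 * t)"

definition Eset :: "real \<Rightarrow> real \<Rightarrow> real \<Rightarrow> real^'n \<Rightarrow> real \<Rightarrow> ((real^'n) \<times> real) set" where
  "Eset T A2 B2 x0 r = {(x, t). x \<in> ball x0 r \<and> 0 < t \<and> t < T \<and> Rfun A2 B2 x t + dist x x0 < r}"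

end

theory Submission
  imports Defs
begin

text \<open>
  A lower bound \<open>g\<close> on the norms of the subgradients of \<open>u\<close> means that \<open>u\<close> drops by at least \<open>g * \<rho>\<close> within every small ball
  of radius \<open>\<rho>\<close>. For the initial datum this is (U). To propagate it, put
  \<open>M x t = Min {u y t | y. dist y x \<le> \<rho> t} + m t\<close> with \<open>\<rho>\<close> growing slightly faster than at rate \<open>C1\<close> and
  \<open>m' = - K3 * m - C1 * \<beta> * \<rho>\<close>. Convexity of \<open>H\<close> makes \<open>M\<close> a viscosity subsolution, \<open>M \<le> u0\<close> holds
  initially near \<open>x0\<close>, and comparison in the dependence cone gives \<open>M \<le> u\<close>. Hence \<open>u\<close> drops by \<open>m t\<close>
  in a ball of radius \<open>\<rho> t\<close>, which forces \<open>norm p \<ge> m t / \<rho> t\<close>.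
\<close>

text \<open>A minimum of subsolutions is in general not a subsolution; this is the obstacle, and
  (H4) removes it by duality: the equation is tested along straight lines whose velocity is a
  subgradient of \<open>H\<close> in \<open>p\<close>. Three costs fix the data. At a minimiser
  \<open>u\<close> differs from \<open>M\<close> by \<open>m\<close>, which costs
  \<open>K3 * m\<close> by (H3). Moving the base point by at most \<open>\<rho>\<close> costs
  \<open>C1 * \<beta> * \<rho>\<close> by (H1). Both are charged to \<open>m'\<close>. The remaining
  error \<open>C1 * \<rho> * norm q\<close> grows with the gradient and cannot be charged there; it
  becomes a change of velocity by at most \<open>C1 * \<rho>\<close>, paid by the growth of the
  radius. The initial radius \<open>\<epsilon>\<close> tends to 0, because a subgradient controls
  \<open>u\<close> only to first order, and then the slack in the growth rate tends to 0. Space is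
  unbounded and the speed \<open>A2 * norm x + B2\<close> grows, so comparison works on compact
  truncated cones. The spatial Lipschitz bound on \<open>u\<close>, needed to confine test
  gradients, comes from the same comparison.\<close>

subsection \<open>Affine minorants of convex functions\<close>

text \<open>Hahn-Banach sandwich: a hyperplane separates the hypograph \<open>?S\<close> of the
  concave function \<open>- K * norm q\<close> from the strict epigraph \<open>?T\<close> of
  \<open>F q - c - a \<bullet> q\<close>. Its slope is the correction to \<open>a\<close>, and
  staying above the cone \<open>?S\<close> bounds that slope by \<open>K\<close>.\<close>

lemma affine_sandwich:
  fixes F :: "'a::euclidean_space \<Rightarrow> real"
  assumes "convex_on UNIV F" "K \<ge> 0" and FG: "\<And>q. F q \<ge> c + a \<bullet> q - K * norm q"
  shows "\<exists>b. norm (b - a) \<le> K \<and> (\<forall>q. F q \<ge> c + b \<bullet> q)"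
proof -
  let ?S = "{z::'a \<times> real. snd z \<le> - K * norm (fst z)}"
  let ?T = "{z::'a \<times> real. F (fst z) - c - a \<bullet> fst z < snd z}"
  have "convex ?S"
  proof (rule convexI, clarsimp)
    fix x y :: 'a and s t u v :: real
    assume h: "s \<le> - (K * norm x)" "t \<le> - (K * norm y)" "0 \<le> u" "0 \<le> v" "u + v = 1"
    have "norm (u *\<^sub>R x + v *\<^sub>R y) \<le> u * norm x + v * norm y"
      using norm_triangle_ineq[of "u *\<^sub>R x" "v *\<^sub>R y"] h by simp
    then have "K * norm (u *\<^sub>R x + v *\<^sub>R y) \<le> K * (u * norm x + v * norm y)"
      using assms(2) by (rule mult_left_mono)
    moreover have "u * s \<le> u * - (K * norm x)" "v * t \<le> v * - (K * norm y)"
      using mult_left_mono[OF h(1) h(3)] mult_left_mono[OF h(2) h(4)] by simp_all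
    ultimately show "u * s + v * t \<le> - (K * norm (u *\<^sub>R x + v *\<^sub>R y))"
      by (simp add: algebra_simps)
  qed
  moreover have "convex ?T"
  proof (rule convexI, clarsimp)
    fix x y :: 'a and s t u v :: real
    assume h: "F x - c - a \<bullet> x < s" "F y - c - a \<bullet> y < t" "0 \<le> u" "0 \<le> v" "u + v = 1"
    have "F (u *\<^sub>R x + v *\<^sub>R y) \<le> u * F x + v * F y"
      using assms(1) h unfolding convex_on_def by auto
    moreover have "u * (F x - c - a \<bullet> x) + v * (F y - c - a \<bullet> y) < u * s + v * t"
    proof (cases "u = 0")
      case False
      then have "u * (F x - c - a \<bullet> x) < u * s" "v * (F y - c - a \<bullet> y) \<le> v * t"
        using h by (auto intro: mult_left_mono)
      then show ?thesis by linarith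
    qed (use h in auto)
    moreover have "u * c + v * c = c" using h(5) by (metis distrib_right mult_1)
    ultimately show "F (u *\<^sub>R x + v *\<^sub>R y) - c - a \<bullet> (u *\<^sub>R x + v *\<^sub>R y) < u * s + v * t"
      by (simp add: algebra_simps inner_add_right)
  qed
  moreover have "?S \<noteq> {}" by (auto intro!: exI[of _ 0])
  moreover have "?T \<noteq> {}" by (auto intro!: exI[of _ 0] exI[of _ "F 0 - c + 1"])
  moreover have "?S \<inter> ?T = {}"
  proof (auto)
    fix x s assume "s \<le> - (K * norm x)" "F x - c - a \<bullet> x < s"
    then show False using FG[of x] by linarith
  qed
  ultimately have "\<exists>a b. a \<noteq> 0 \<and> (\<forall>x\<in>?S. a \<bullet> x \<le> b) \<and> (\<forall>x\<in>?T. a \<bullet> x \<ge> b)"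
    by (rule separating_hyperplane_sets)
  then obtain vw d where vw: "vw \<noteq> 0" "\<forall>x\<in>?S. vw \<bullet> x \<le> d" "\<forall>x\<in>?T. d \<le> vw \<bullet> x"
    by (elim exE conjE) (rule that)
  obtain v w where vwe: "vw = (v, w)" by (cases vw)
  have S: "v \<bullet> q + w * z \<le> d" if "z \<le> - K * norm q" for q z
    using vw(2) that vwe by auto
  have T: "d \<le> v \<bullet> q + w * z" if "F q - c - a \<bullet> q < z" for q z
    using vw(3) that vwe by auto
  \<comment> \<open>Both sets lie over every point \<open>q\<close>, which excludes a vertical
    hyperplane (\<open>w = 0\<close>); \<open>?T\<close> is unbounded upwards, which excludes
    \<open>w < 0\<close>.\<close>
  have w: "w > 0"
  proof (rule ccontr)
    assume "\<not> w > 0"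
    show False
    proof (cases "w = 0")
      case True
      have *: "v \<bullet> q = d" for q
        using S[of "- K * norm q" q] T[of q "F q - c - a \<bullet> q + 1"] True by auto
      have "v \<bullet> v = 0" using *[of v] *[of 0] by simp
      then show False using vw(1) vwe True by (simp add: zero_prod_def)
    next
      case False
      with \<open>\<not> w > 0\<close> have "w < 0" by simp
      define z where "z = max (F 0 - c + 1) (d / w + 1)"
      have "d \<le> w * z" using T[of 0 z] by (auto simp: z_def)
      moreover have "w * z \<le> w * (d / w + 1)" using \<open>w < 0\<close> by (intro mult_left_mono_neg) (auto simp: z_def)
      moreover have "w * (d / w + 1) = d + w" using \<open>w < 0\<close> by (simp add: field_simps)
      ultimately show False using \<open>w < 0\<close> by linarith
    qed
  qed
  define b where "b = - (1 / w) *\<^sub>R v"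
  have bq: "b \<bullet> q = - (v \<bullet> q) / w" for q by (simp add: b_def)
  have d0: "0 \<le> d" using S[of 0 0] by simp
  have 1: "F q \<ge> c + (a + b) \<bullet> q" for q
  proof -
    have "F q - c - a \<bullet> q \<ge> b \<bullet> q"
    proof (rule dense_ge)
      fix z assume "F q - c - a \<bullet> q < z"
      from T[OF this] d0 have "- (v \<bullet> q) \<le> w * z" by linarith
      then show "b \<bullet> q \<le> z" using w by (simp add: bq field_simps)
    qed
    then show ?thesis by (simp add: inner_add_left)
  qed
  have "norm b \<le> K"
  proof (rule ccontr)
    assume "\<not> norm b \<le> K"
    then have k: "norm b * (norm b - K) > 0" using assms(2) by (intro mult_pos_pos) auto
    \<comment> \<open>\<open>?S\<close> is a cone, so a slope exceeding \<open>K\<close> would make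
      the separating functional unbounded on it; this multiple of \<open>- b\<close> already gives
      the value \<open>d + w > d\<close>.\<close>
    define l where "l = (d / w + 1) / (norm b * (norm b - K))"
    have l: "l \<ge> 0" using k d0 w by (simp add: l_def)
    have "v \<bullet> (- (l *\<^sub>R b)) + w * (- K * norm (- (l *\<^sub>R b))) \<le> d" by (rule S) simp
    moreover have "v = - w *\<^sub>R b" using w by (simp add: b_def)
    ultimately have "w * (l * (norm b * (norm b - K))) \<le> d"
      using l by (simp add: algebra_simps dot_square_norm power2_eq_square)
    moreover have "l * (norm b * (norm b - K)) = d / w + 1" using k unfolding l_def by (metis nonzero_divide_eq_eq less_irrefl)
    ultimately have "w * (d / w + 1) \<le> d" by simp
    moreover have "w * (d / w + 1) = d + w" using w by (simp add: field_simps)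
    ultimately show False using w by linarith
  qed
  then show ?thesis using 1 by (intro exI[of _ "a + b"]) auto
qed

text \<open>The Lipschitz bound at \<open>p\<close> gives the translate the minorant
  \<open>F p - K * norm q\<close>, so the sandwich lemma with \<open>a = 0\<close> yields a
  supporting hyperplane.\<close>

lemma convex_lipschitz_subgradient:
  fixes F :: "'a::euclidean_space \<Rightarrow> real"
  assumes F: "convex_on UNIV F" and "K \<ge> 0" and L: "\<And>q. \<bar>F p - F q\<bar> \<le> K * dist p q"
  shows "\<exists>a. \<forall>q. F q \<ge> F p + a \<bullet> (q - p)"
proof -
  have "convex_on UNIV (\<lambda>q. F (p + q))"
    using F unfolding convex_on_def
  proof (clarsimp)
    fix x y :: 'a and u v :: real
    assume h: "\<forall>x y u. 0 \<le> u \<longrightarrow> (\<forall>v\<ge>0. u + v = 1 \<longrightarrow> F (u *\<^sub>R x + v *\<^sub>R y) \<le> u * F x + v * F y)"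
      "0 \<le> u" "0 \<le> v" "u + v = 1"
    have "F (u *\<^sub>R (p + x) + v *\<^sub>R (p + y)) \<le> u * F (p + x) + v * F (p + y)" using h by blast
    moreover have "u *\<^sub>R (p + x) + v *\<^sub>R (p + y) = p + (u *\<^sub>R x + v *\<^sub>R y)"
      using h(4) by (simp add: algebra_simps) (metis scaleR_left_distrib scaleR_one add.assoc)
    ultimately show "F (p + (u *\<^sub>R x + v *\<^sub>R y)) \<le> u * F (p + x) + v * F (p + y)" by simp
  qed
  moreover have "F (p + q) \<ge> F p + 0 \<bullet> q - K * norm q" for q
    using L[of "p + q"] by (auto simp: dist_norm)
  ultimately obtain b where "\<forall>q. F (p + q) \<ge> F p + b \<bullet> q"
    using affine_sandwich[of "\<lambda>q. F (p + q)" K "F p" 0] assms(2) by auto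
  then show ?thesis by (metis add_diff_cancel_left' diff_add_cancel add.commute)
qed

subsection \<open>Continuously differentiable test functions\<close>

lemma C1_on_add: "C1_on S f f' \<Longrightarrow> C1_on S g g' \<Longrightarrow> C1_on S (\<lambda>z. f z + g z) (\<lambda>z. f' z + g' z)"
  unfolding C1_on_def by (auto intro!: continuous_intros derivative_eq_intros simp: inner_add_left)

lemma C1_on_const: "C1_on S (\<lambda>z. c) (\<lambda>z. 0)"
  unfolding C1_on_def by (auto intro!: continuous_intros derivative_eq_intros)

lemma C1_on_uminus: "C1_on S f f' \<Longrightarrow> C1_on S (\<lambda>z. - f z) (\<lambda>z. - f' z)"
  unfolding C1_on_def by (auto intro!: continuous_intros derivative_eq_intros simp: inner_minus_left)

lemma C1_on_imp_continuous: "C1_on S f f' \<Longrightarrow> continuous_on S f"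
  unfolding C1_on_def
  by (meson continuous_at_imp_continuous_on has_derivative_continuous)

lemma C1_on_mult: "C1_on S f f' \<Longrightarrow> C1_on S g g' \<Longrightarrow> C1_on S (\<lambda>z. f z * g z) (\<lambda>z. f z *\<^sub>R g' z + g z *\<^sub>R f' z)"
  using C1_on_imp_continuous[of S f f'] C1_on_imp_continuous[of S g g']
  unfolding C1_on_def
  by (auto intro!: continuous_intros derivative_eq_intros simp: inner_add_left algebra_simps)

lemma C1_on_compose_real:
  assumes f: "C1_on S f f'" and k: "\<And>r. (k has_real_derivative k' r) (at r)" "continuous_on UNIV k'"
  shows "C1_on S (\<lambda>z. k (f z)) (\<lambda>z. k' (f z) *\<^sub>R f' z)"
  unfolding C1_on_def
proof (intro conjI ballI)
  fix z assume "z \<in> S"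
  then have "(f has_derivative (\<lambda>h. f' z \<bullet> h)) (at z)" using f by (auto simp: C1_on_def)
  moreover have "(k has_derivative (\<lambda>h. k' (f z) * h)) (at (f z))"
    using k(1) by (simp add: has_field_derivative_def)
  ultimately show "((\<lambda>z. k (f z)) has_derivative (\<lambda>h. (k' (f z) *\<^sub>R f' z) \<bullet> h)) (at z)"
    by (auto dest: has_derivative_compose[of f "\<lambda>h. f' z \<bullet> h" z UNIV k "\<lambda>h. k' (f z) * h"])
next
  have "continuous_on S (\<lambda>z. k' (f z))"
    by (rule continuous_on_compose2[OF k(2) C1_on_imp_continuous[OF f]]) auto
  then show "continuous_on S (\<lambda>z. k' (f z) *\<^sub>R f' z)"
    using f by (auto simp: C1_on_def intro!: continuous_intros)
qed

lemma C1_on_fst: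
  assumes "C1_on UNIV f f'"
  shows "C1_on UNIV (\<lambda>z. f (fst z)) (\<lambda>z. (f' (fst z), 0::real))"
  unfolding C1_on_def
proof (intro conjI ballI)
  fix z :: "'a \<times> real"
  have "(f has_derivative (\<lambda>h. f' (fst z) \<bullet> h)) (at (fst z))" using assms by (auto simp: C1_on_def)
  from has_derivative_compose[OF has_derivative_fst[OF has_derivative_ident] this]
  show "((\<lambda>z. f (fst z)) has_derivative (\<lambda>h. (f' (fst z), 0) \<bullet> h)) (at z)"
    by (simp add: inner_prod_def)
next
  have "continuous_on UNIV (\<lambda>z::'a \<times> real. f' (fst z))"
    by (rule continuous_on_compose2[of UNIV f']) (use assms in \<open>auto simp: C1_on_def intro!: continuous_intros\<close>)
  then show "continuous_on UNIV (\<lambda>z::'a \<times> real. (f' (fst z), 0::real))" by (intro continuous_on_Pair continuous_on_const)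
qed

lemma C1_on_snd:
  assumes "\<And>r. (k has_real_derivative k' r) (at r)" "continuous_on UNIV k'"
  shows "C1_on UNIV (\<lambda>z::'a::euclidean_space \<times> real. k (snd z)) (\<lambda>z. (0, k' (snd z)))"
proof -
  have "C1_on UNIV (snd :: 'a \<times> real \<Rightarrow> real) (\<lambda>z. (0, 1))"
    unfolding C1_on_def by (auto intro!: continuous_intros derivative_eq_intros simp: inner_prod_def)
  from C1_on_compose_real[OF this assms] show ?thesis by (simp add: scaleR_prod_def)
qed

text \<open>A differentiable replacement for the norm, exceeding it by at most \<open>e\<close>
  (\<open>e \<ge> 0\<close>), with gradient shorter than 1 (\<open>e \<noteq> 0\<close>). The bound
  1 keeps Lipschitz constants and propagation speeds the same as for the norm.\<close>

definition smooth_norm :: "real \<Rightarrow> 'a::real_inner \<Rightarrow> real" where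
  "smooth_norm e x = sqrt (e\<^sup>2 + x \<bullet> x)"

definition smooth_norm_grad :: "real \<Rightarrow> 'a::real_inner \<Rightarrow> 'a" where
  "smooth_norm_grad e x = (1 / smooth_norm e x) *\<^sub>R x"

lemma smooth_norm_pos: "e \<noteq> 0 \<Longrightarrow> smooth_norm e x > 0"
  unfolding smooth_norm_def by (simp add: add_pos_nonneg)

lemma norm_le_smooth_norm: "norm x \<le> smooth_norm e x"
  unfolding smooth_norm_def norm_eq_sqrt_inner by simp

lemma norm_less_smooth_norm: "e \<noteq> 0 \<Longrightarrow> norm x < smooth_norm e x"
  unfolding smooth_norm_def norm_eq_sqrt_inner by simp

lemma smooth_norm_le: "e \<ge> 0 \<Longrightarrow> smooth_norm e x \<le> norm x + e"
  using sqrt_sum_squares_le_sum[of e "norm x"]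
  unfolding smooth_norm_def by (simp add: dot_square_norm add.commute)

lemma norm_smooth_norm_grad: "e \<noteq> 0 \<Longrightarrow> norm (smooth_norm_grad e x) < 1"
  using norm_less_smooth_norm[of e x] smooth_norm_pos[of e x]
  unfolding smooth_norm_grad_def by (simp add: field_simps)

lemma C1_on_smooth_norm:
  fixes y :: "'a::euclidean_space"
  assumes "e \<noteq> 0"
  shows "C1_on S (\<lambda>x. smooth_norm e (x - y)) (\<lambda>x. smooth_norm_grad e (x - y))"
  unfolding C1_on_def
proof (intro conjI ballI)
  fix z
  have p: "e\<^sup>2 + (z - y) \<bullet> (z - y) > 0" using assms by (simp add: add_pos_nonneg)
  have d: "((\<lambda>x. e\<^sup>2 + (x - y) \<bullet> (x - y)) has_derivative (\<lambda>h. 2 * ((z - y) \<bullet> h))) (at z)"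
    by (rule derivative_eq_intros refl)+ (simp add: inner_commute)
  show "((\<lambda>x. smooth_norm e (x - y)) has_derivative (\<lambda>h. smooth_norm_grad e (z - y) \<bullet> h)) (at z)"
    unfolding smooth_norm_grad_def smooth_norm_def
    by (rule has_derivative_eq_rhs[OF has_derivative_real_sqrt[OF p d]]) (auto simp: fun_eq_iff inverse_eq_divide)
next
  have "e\<^sup>2 + (z - y) \<bullet> (z - y) \<noteq> 0" for z using assms by (simp add: add_pos_nonneg less_imp_neq[symmetric])
  then show "continuous_on S (\<lambda>x. smooth_norm_grad e (x - y))"
    unfolding smooth_norm_grad_def smooth_norm_def by (intro continuous_intros) auto
qed

text \<open>The squared positive part serves below as a one-sided penalty: it vanishes up to
  \<open>c\<close> and is still continuously differentiable, so it may enter test functions.\<close>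

lemma has_real_derivative_pos_part_square:
  "((\<lambda>x. (max 0 (x - c))\<^sup>2) has_real_derivative 2 * max 0 (x - c)) (at (x::real))"
proof (cases x c rule: linorder_cases)
  case less
  have "((\<lambda>x. 0) has_real_derivative 2 * max 0 (x - c)) (at x)" using less by (auto intro!: derivative_eq_intros)
  then show ?thesis
    by (rule DERIV_cong_ev[THEN iffD1, rotated -1])
      (use less in \<open>auto intro!: eventually_nhds_in_open[of "{..<c}", THEN eventually_mono] simp: max_def\<close>)
next
  case greater
  have "((\<lambda>x. (x - c)\<^sup>2) has_real_derivative 2 * max 0 (x - c)) (at x)"
    using greater by (auto intro!: derivative_eq_intros)
  then show ?thesis
    by (rule DERIV_cong_ev[THEN iffD1, rotated -1])
      (use greater in \<open>auto intro!: eventually_nhds_in_open[of "{c<..}", THEN eventually_mono] simp: max_def\<close>)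
next
  case equal
  have "((\<lambda>h. (max 0 (h - c))\<^sup>2 / (h - c)) \<longlongrightarrow> 0) (at c)"
  proof (rule tendsto_sandwich[of "\<lambda>h. - \<bar>h - c\<bar>" _ _ "\<lambda>h. \<bar>h - c\<bar>"])
    have "\<bar>(max 0 (h - c))\<^sup>2 / (h - c)\<bar> \<le> \<bar>h - c\<bar>" for h
      by (auto simp: max_def power2_eq_square)
    then have "- \<bar>h - c\<bar> \<le> (max 0 (h - c))\<^sup>2 / (h - c) \<and> (max 0 (h - c))\<^sup>2 / (h - c) \<le> \<bar>h - c\<bar>" for h
      unfolding abs_le_iff[of "_ / _"] by (metis minus_le_iff)
    then show "\<forall>\<^sub>F h in at c. - \<bar>h - c\<bar> \<le> (max 0 (h - c))\<^sup>2 / (h - c)"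
      "\<forall>\<^sub>F h in at c. (max 0 (h - c))\<^sup>2 / (h - c) \<le> \<bar>h - c\<bar>"
      by (auto intro!: always_eventually)
  qed (auto intro!: tendsto_eq_intros)
  then show ?thesis using equal by (simp add: has_field_derivative_iff)
qed

subsection \<open>Comparison in dependence cones\<close>

text \<open>Supersolutions appear below as subsolutions of the reflected problem: \<open>u\<close> is a supersolution
  for \<open>H\<close> iff \<open>- u\<close> is a subsolution for \<open>\<lambda>x t v p. - H x t (- v) (- p)\<close>.\<close>

definition subsolution ::
  "real \<Rightarrow> ('a::euclidean_space \<Rightarrow> real \<Rightarrow> real \<Rightarrow> 'a \<Rightarrow> real) \<Rightarrow> ('a \<Rightarrow> real \<Rightarrow> real) \<Rightarrow> bool" where
  "subsolution T H W \<longleftrightarrow> (\<forall>\<phi> g x t. C1_on UNIV \<phi> g \<longrightarrow> 0 < t \<longrightarrow> t < T \<longrightarrow>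
     (\<exists>e>0. \<forall>y s. 0 < s \<and> s < T \<and> dist (y, s) (x, t) < e \<longrightarrow> W y s - \<phi> (y, s) \<le> W x t - \<phi> (x, t)) \<longrightarrow>
     snd (g (x, t)) + H x t (W x t) (fst (g (x, t))) \<le> 0)"

lemma subsolutionD:
  assumes "subsolution T H W" "C1_on UNIV \<phi> g" "0 < t" "t < T" "e > 0"
    and "\<And>y s. 0 < s \<Longrightarrow> s < T \<Longrightarrow> dist (y, s) (x, t) < e \<Longrightarrow> W y s - \<phi> (y, s) \<le> W x t - \<phi> (x, t)"
  shows "snd (g (x, t)) + H x t (W x t) (fst (g (x, t))) \<le> 0"
  using assms unfolding subsolution_def by blast

text \<open>The exponential factor creates a zeroth-order term with coefficient \<open>l\<close>,
  able to dominate the dependence of \<open>H\<close> on \<open>v\<close>. The barrier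
  \<open>G (h z)\<close> leaves no trace in the conclusion: by \<open>H2\<close> its gradient
  changes \<open>H\<close> by at most \<open>c\<close> times its length, and by
  \<open>barrier\<close> its time derivative pays for that.\<close>

lemma subsolution_scaled_barrier:
  fixes W :: "'a::euclidean_space \<Rightarrow> real \<Rightarrow> real"
  assumes sub: "subsolution T H W" and \<psi>: "C1_on UNIV \<psi> g" and h: "C1_on UNIV h k"
    and G: "\<And>r. (G has_real_derivative G' r) (at r)" "continuous_on UNIV G'" "\<And>r. G' r \<ge> 0"
    and t: "0 < t" "t < T"
    and barrier: "c * norm (fst (k (x, t))) \<le> snd (k (x, t))"
    and H2: "\<And>v p q. \<bar>H x t v p - H x t v q\<bar> \<le> c * dist p q"
    and e: "e > 0"
    and max: "\<And>y s. 0 < s \<Longrightarrow> s < T \<Longrightarrow> dist (y, s) (x, t) < e \<Longrightarrow>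
      exp (- l * s) * W y s - \<psi> (y, s) - G (h (y, s)) \<le> exp (- l * t) * W x t - \<psi> (x, t) - G (h (x, t))"
  shows "snd (g (x, t)) + l * (exp (- l * t) * W x t)
    + exp (- l * t) * H x t (W x t) (exp (l * t) *\<^sub>R fst (g (x, t))) \<le> 0"
proof -
  \<comment> \<open>This constant makes \<open>\<phi>\<close> touch \<open>W\<close> at
    \<open>(x, t)\<close>, so differentiating the factor \<open>exp (l * s)\<close> contributes
    exactly \<open>l * W x t\<close>.\<close>
  define d where "d = exp (- l * t) * W x t - \<psi> (x, t) - G (h (x, t))"
  define \<phi> where "\<phi> = (\<lambda>z::'a \<times> real. exp (l * snd z) * ((\<psi> z + G (h z)) + d))"
  define \<Psi> where "\<Psi> = (\<lambda>z. exp (l * snd z) *\<^sub>R ((g z + G' (h z) *\<^sub>R k z) + 0) + ((\<psi> z + G (h z)) + d) *\<^sub>R (0, l * exp (l * snd z)))"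
  have "C1_on UNIV (\<lambda>z::'a \<times> real. exp (l * snd z)) (\<lambda>z. (0, l * exp (l * snd z)))"
    by (rule C1_on_snd) (auto intro!: derivative_eq_intros continuous_intros)
  then have C: "C1_on UNIV \<phi> \<Psi>"
    unfolding \<phi>_def \<Psi>_def
    by (intro C1_on_mult C1_on_add \<psi> C1_on_const C1_on_compose_real[OF h G(1,2)])
  have e1: "exp (l * s) * exp (- l * s) = 1" for s by (simp flip: exp_add)
  have eq: "\<psi> (x, t) + G (h (x, t)) + d = exp (- l * t) * W x t" by (simp add: d_def)
  have main: "snd (\<Psi> (x, t)) + H x t (W x t) (fst (\<Psi> (x, t))) \<le> 0"
  proof (rule subsolutionD[OF sub C t e])
    fix y s assume "0 < s" "s < T" "dist (y, s) (x, t) < e"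
    from max[OF this] have "exp (- l * s) * W y s \<le> \<psi> (y, s) + G (h (y, s)) + d" by (simp add: d_def)
    then have "exp (l * s) * (exp (- l * s) * W y s) \<le> exp (l * s) * (\<psi> (y, s) + G (h (y, s)) + d)"
      by (rule mult_left_mono) simp
    also have "exp (l * s) * (exp (- l * s) * W y s) = W y s" using e1[of s] by (metis mult.assoc mult_1)
    finally have "W y s \<le> \<phi> (y, s)" by (simp add: \<phi>_def)
    moreover have "\<phi> (x, t) = W x t" using e1[of t] by (simp add: \<phi>_def eq flip: mult.assoc)
    ultimately show "W y s - \<phi> (y, s) \<le> W x t - \<phi> (x, t)" by simp
  qed
  have s: "snd (\<Psi> (x, t)) = exp (l * t) * (snd (g (x, t)) + G' (h (x, t)) * snd (k (x, t))) + l * W x t"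
    using e1[of t] by (simp add: \<Psi>_def eq) (metis (no_types, opaque_lifting) mult.commute mult.left_commute mult_1)
  have f: "fst (\<Psi> (x, t)) = exp (l * t) *\<^sub>R (fst (g (x, t)) + G' (h (x, t)) *\<^sub>R fst (k (x, t)))"
    by (simp add: \<Psi>_def)
  have "H x t (W x t) (exp (l * t) *\<^sub>R fst (g (x, t))) - H x t (W x t) (fst (\<Psi> (x, t)))
      \<le> c * dist (exp (l * t) *\<^sub>R fst (g (x, t))) (fst (\<Psi> (x, t)))"
    using H2 abs_le_D1 by blast
  also have "\<dots> = exp (l * t) * G' (h (x, t)) * (c * norm (fst (k (x, t))))"
    using G(3) by (simp add: f dist_norm scaleR_add_right)
  also have "\<dots> \<le> exp (l * t) * G' (h (x, t)) * snd (k (x, t))"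
    using barrier G(3) by (intro mult_left_mono) auto
  finally have "exp (l * t) * snd (g (x, t)) + l * W x t + H x t (W x t) (exp (l * t) *\<^sub>R fst (g (x, t))) \<le> 0"
    using main unfolding s by (simp add: algebra_simps)
  then have "exp (- l * t) * (exp (l * t) * snd (g (x, t)) + l * W x t + H x t (W x t) (exp (l * t) *\<^sub>R fst (g (x, t)))) \<le> 0"
    by (simp add: mult_le_0_iff)
  moreover have "exp (- l * t) * (exp (l * t) * snd (g (x, t))) = snd (g (x, t))"
    using e1[of t] by (metis mult.assoc mult.commute mult_1)
  ultimately show ?thesis by (simp only: distrib_left mult.left_commute[of _ l])
qed

lemma continuous_on_Hamiltonian:
  assumes "continuous_on (UNIV \<times> {0..T} \<times> UNIV \<times> UNIV) (\<lambda>(x, t, v, p). H x t v p)"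
    and "continuous_on S a" "continuous_on S b" "continuous_on S c" "continuous_on S d"
    and "\<And>z. z \<in> S \<Longrightarrow> b z \<in> {0..T}"
  shows "continuous_on S (\<lambda>z. H (a z) (b z) (c z) (d z))"
proof -
  have "continuous_on S (\<lambda>z. (a z, b z, c z, d z))" using assms(2-5) by (intro continuous_on_Pair)
  moreover have "(\<lambda>z. (a z, b z, c z, d z)) ` S \<subseteq> UNIV \<times> {0..T} \<times> UNIV \<times> UNIV" using assms(6) by auto
  ultimately show ?thesis using continuous_on_compose2[OF assms(1)] by fastforce
qed

lemma C1_on_doubling_test:
  fixes y :: "'a::euclidean_space"
  assumes "e \<noteq> 0"
  shows "C1_on UNIV (\<lambda>z. L * smooth_norm e (fst z - y) + c * (snd z - s)\<^sup>2)
    (\<lambda>z. (L *\<^sub>R smooth_norm_grad e (fst z - y), 2 * c * (snd z - s)))"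
proof -
  have "C1_on UNIV (\<lambda>z::'a \<times> real. L * smooth_norm e (fst z - y) + c * (snd z - s)\<^sup>2)
    (\<lambda>z. (L *\<^sub>R (smooth_norm_grad e (fst z - y), 0) + smooth_norm e (fst z - y) *\<^sub>R 0) + (0, 2 * c * (snd z - s)))"
    by (intro C1_on_add C1_on_mult C1_on_const C1_on_snd C1_on_fst[OF C1_on_smooth_norm[OF assms]])
      (auto intro!: derivative_eq_intros continuous_intros)
  then show ?thesis by simp
qed

text \<open>Doubling of variables with the penalisation \<open>L * smooth_norm e (x - y)\<close>. Because the initial
  data are Lipschitz, no limit \<open>L \<rightarrow> \<infinity>\<close> is needed, so one argument yields both the Lipschitz estimate
  (with \<open>W = u\<close>) and the comparison \<open>W \<le> u\<close> (with \<open>x = y\<close>).\<close>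

lemma comparison:
  fixes W u :: "'a::euclidean_space \<Rightarrow> real \<Rightarrow> real"
  assumes T1: "T1 < T"
    and Hcont: "continuous_on (UNIV \<times> {0..T} \<times> UNIV \<times> UNIV) (\<lambda>(x, t, v, p). H x t v p)"
    and H1: "C \<ge> 0" "\<And>x y t v p. t \<in> {0..T} \<Longrightarrow> \<bar>H x t v p - H y t v p\<bar> \<le> C * (1 + norm p) * dist x y"
    and H2: "\<And>x t v p q. t \<in> {0..T} \<Longrightarrow> \<bar>H x t v p - H x t v q\<bar> \<le> (A2 * norm x + B2) * dist p q"
    and K3: "K3 \<ge> 0"
    and H3: "\<And>x t v w p. t \<in> {0..T} \<Longrightarrow> \<bar>H x t v p - H x t w p\<bar> \<le> K3 * \<bar>v - w\<bar>"
    and sub: "subsolution T H W"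
    and super: "subsolution T (\<lambda>x t v p. - H x t (- v) (- p)) (\<lambda>x t. - u x t)"
    and Wc: "continuous_on (UNIV \<times> {0..<T}) (\<lambda>(x, t). W x t)"
    and uc: "continuous_on (UNIV \<times> {0..<T}) (\<lambda>(x, t). u x t)"
    and h: "C1_on UNIV h k" "\<And>x t. 0 < t \<Longrightarrow> (A2 * norm x + B2) * norm (fst (k (x, t))) \<le> snd (k (x, t))"
    and bd: "bounded {z. 0 \<le> snd z \<and> h z \<le> h1}" and hT: "\<And>z. h z \<le> h1 \<Longrightarrow> snd z \<le> T1"
    and h01: "h0 < h1" and L: "L \<ge> 1"
    and init: "\<And>x y. h (x, 0) \<le> h1 \<Longrightarrow> h (y, 0) \<le> h1 \<Longrightarrow> W x 0 - u y 0 \<le> L * dist x y"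
    and xyt: "h (xb, tb) \<le> h0" "h (yb, tb) \<le> h0" "0 \<le> tb"
  shows "W xb tb - u yb tb \<le> exp ((K3 + 2 * C + 1) * tb) * (L * dist xb yb)"
proof (rule ccontr)
  assume neg: "\<not> ?thesis"
  \<comment> \<open>\<open>K3\<close> absorbs the error from \<open>H3\<close> and
    \<open>2 * C\<close> the one from \<open>H1\<close>, where \<open>L \<ge> 1\<close> gives
    \<open>1 + L \<le> 2 * L\<close>; the surplus 1 produces the contradiction.\<close>
  define l where "l = K3 + 2 * C + 1"
  define K where "K = {z. 0 \<le> snd z \<and> h z \<le> h1}"
  define w where "w = (\<lambda>z. exp (- l * snd z) * W (fst z) (snd z))"
  define v where "v = (\<lambda>z. exp (- l * snd z) * u (fst z) (snd z))"
  have hc: "continuous_on UNIV h" using h(1) by (rule C1_on_imp_continuous)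
  have "closed K" unfolding K_def
    by (intro closed_Collect_conj closed_Collect_le continuous_intros hc)
  then have K: "compact K" using bd by (simp add: K_def compact_eq_bounded_closed)
  have KT: "0 \<le> snd z" "snd z \<le> T1" "snd z < T" "h z \<le> h1" if "z \<in> K" for z
    using that hT[of z] T1 by (auto simp: K_def)
  have Wk: "continuous_on K (\<lambda>z. W (fst z) (snd z))" 
    using continuous_on_subset[OF Wc, of K] KT by (force simp: case_prod_unfold)
  have uk: "continuous_on K (\<lambda>z. u (fst z) (snd z))"
    using continuous_on_subset[OF uc, of K] KT by (force simp: case_prod_unfold)
  have wc: "continuous_on K w" and vc: "continuous_on K v"
    unfolding w_def v_def by (intro continuous_intros Wk uk)+
  \<comment> \<open>Half of the excess over the claimed bound; the other half pays for smoothing the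
    norm, \<open>e\<close> being chosen with \<open>L * e = \<sigma>\<close>.\<close>
  define \<sigma> where "\<sigma> = (w (xb, tb) - v (yb, tb) - L * dist xb yb) / 2"
  have \<sigma>: "\<sigma> > 0"
  proof -
    have "exp (l * tb) * (L * dist xb yb) < W xb tb - u yb tb" using neg by (simp add: l_def)
    then have "exp (- l * tb) * (exp (l * tb) * (L * dist xb yb)) < exp (- l * tb) * (W xb tb - u yb tb)"
      by simp
    also have "exp (- l * tb) * (exp (l * tb) * (L * dist xb yb)) = L * dist xb yb"
      by (simp flip: exp_add mult.assoc)
    finally show ?thesis by (simp add: \<sigma>_def w_def v_def algebra_simps)
  qed
  define e where "e = \<sigma> / L"
  have e: "e > 0" "L * e = \<sigma>" using L \<sigma> by (auto simp: e_def)
  obtain Bw where Bw: "\<And>z. z \<in> K \<Longrightarrow> \<bar>w z\<bar> \<le> Bw"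
    using compact_imp_bounded[OF compact_continuous_image[OF wc K]] unfolding bounded_iff by auto
  obtain Bv where Bv: "\<And>z. z \<in> K \<Longrightarrow> \<bar>v z\<bar> \<le> Bv"
    using compact_imp_bounded[OF compact_continuous_image[OF vc K]] unfolding bounded_iff by auto
  have zb: "(xb, tb) \<in> K" "(yb, tb) \<in> K" using xyt h01 by (auto simp: K_def)
  have B0: "Bw \<ge> 0" "Bv \<ge> 0" using Bw[OF zb(1)] Bv[OF zb(1)] by auto
  \<comment> \<open>This height makes \<open>G h1 = Bw + Bv\<close>, so a value as large as
    \<open>\<sigma>\<close> is impossible where \<open>h = h1\<close>, and the maximum points
    satisfy \<open>h < h1\<close>.\<close>
  define B where "B = (Bw + Bv) / (h1 - h0)\<^sup>2"
  have B: "B \<ge> 0" "B * (h1 - h0)\<^sup>2 = Bw + Bv" using h01 B0 by (auto simp: B_def)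
  define G where "G = (\<lambda>r. B * (max 0 (r - h0))\<^sup>2)"
  define G' where "G' = (\<lambda>r. B * (2 * max 0 (r - h0)))"
  have G: "\<And>r. (G has_real_derivative G' r) (at r)" "continuous_on UNIV G'" "\<And>r. G' r \<ge> 0"
    unfolding G_def G'_def using B(1)
    by (auto intro!: DERIV_cmult has_real_derivative_pos_part_square continuous_intros)
  have G0: "G r \<ge> 0" for r using B(1) by (simp add: G_def)
  have Gc: "continuous_on UNIV G" unfolding G_def by (intro continuous_intros)
  \<comment> \<open>Only the time doubling is removed by a limit: \<open>H1\<close> controls
    \<open>H\<close> in \<open>x\<close> quantitatively, while in \<open>t\<close> there is only
    continuity.\<close>
  define P where "P = (\<lambda>(n::nat) (z, z'). w z - v z' - L * smooth_norm e (fst z - fst z')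
      - G (h z) - G (h z') - real (Suc n) * (snd z - snd z')\<^sup>2)"
  have Pc: "continuous_on (K \<times> K) (P n)" for n
  proof -
    have "continuous_on (K \<times> K) (\<lambda>p. w (fst p))" "continuous_on (K \<times> K) (\<lambda>p. v (snd p))"
      by (rule continuous_on_compose2[OF wc] continuous_on_compose2[OF vc]; auto intro!: continuous_intros)+
    moreover have "continuous_on (K \<times> K) (\<lambda>p. G (h (fst p)))" "continuous_on (K \<times> K) (\<lambda>p. G (h (snd p)))"
      by (rule continuous_on_compose2[OF Gc continuous_on_compose2[OF hc]]; auto intro!: continuous_intros)+
    ultimately show ?thesis
      unfolding P_def smooth_norm_def case_prod_unfold by (intro continuous_intros)
  qed
  have "\<forall>n. \<exists>Z. Z \<in> K \<times> K \<and> (\<forall>Y\<in>K \<times> K. P n Y \<le> P n Z)"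
    using continuous_attains_sup[OF compact_Times[OF K K] _ Pc] zb by blast
  then obtain Z where Z: "\<And>n. Z n \<in> K \<times> K" "\<And>n Y. Y \<in> K \<times> K \<Longrightarrow> P n Y \<le> P n (Z n)"
    by metis
  have P\<sigma>: "\<sigma> \<le> P n (Z n)" for n
  proof -
    have "G (h (xb, tb)) = 0" "G (h (yb, tb)) = 0" using xyt by (auto simp: G_def)
    moreover have "L * smooth_norm e (xb - yb) \<le> L * (dist xb yb + e)"
      using smooth_norm_le[of e "xb - yb"] e(1) L by (auto simp: dist_norm)
    moreover have "w (xb, tb) - v (yb, tb) = 2 * \<sigma> + L * dist xb yb" unfolding \<sigma>_def by argo
    ultimately have "\<sigma> \<le> P n ((xb, tb), (yb, tb))"
      using e(2) by (simp add: P_def distrib_left)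
    then show ?thesis using Z(2)[of "((xb, tb), (yb, tb))" n] zb by simp
  qed
  have tt: "real (Suc n) * (snd (fst (Z n)) - snd (snd (Z n)))\<^sup>2 \<le> Bw + Bv" 
    and Ghlt: "h (fst (Z n)) < h1" "h (snd (Z n)) < h1"
    and W\<sigma>: "\<sigma> + L * smooth_norm e (fst (fst (Z n)) - fst (snd (Z n))) \<le> w (fst (Z n)) - v (snd (Z n))" for n
  proof -
    have Zn: "fst (Z n) \<in> K" "snd (Z n) \<in> K" using Z(1)[of n] by auto
    have s: "L * smooth_norm e (fst (fst (Z n)) - fst (snd (Z n))) \<ge> 0"
      using L smooth_norm_pos[of e "fst (fst (Z n)) - fst (snd (Z n))"] e(1) by simp
    have q: "real (Suc n) * (snd (fst (Z n)) - snd (snd (Z n)))\<^sup>2 \<ge> 0" by simp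
    have PZ: "\<sigma> \<le> w (fst (Z n)) - v (snd (Z n)) - L * smooth_norm e (fst (fst (Z n)) - fst (snd (Z n)))
      - G (h (fst (Z n))) - G (h (snd (Z n))) - real (Suc n) * (snd (fst (Z n)) - snd (snd (Z n)))\<^sup>2"
      using P\<sigma>[of n] by (simp add: P_def case_prod_unfold)
    have wv: "w (fst (Z n)) - v (snd (Z n)) \<le> Bw + Bv" using Bw[OF Zn(1)] Bv[OF Zn(2)] by linarith
    have g: "G (h (fst (Z n))) \<ge> 0" "G (h (snd (Z n))) \<ge> 0" using G0 by auto
    show "real (Suc n) * (snd (fst (Z n)) - snd (snd (Z n)))\<^sup>2 \<le> Bw + Bv"
      using s q PZ wv g \<sigma> by linarith
    show "\<sigma> + L * smooth_norm e (fst (fst (Z n)) - fst (snd (Z n))) \<le> w (fst (Z n)) - v (snd (Z n))"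
      using s q PZ wv g \<sigma> by linarith
    have "G (h (fst (Z n))) < Bw + Bv" "G (h (snd (Z n))) < Bw + Bv"
      using s q PZ wv g \<sigma> by linarith+
    moreover have "G h1 = Bw + Bv" using B h01 by (simp add: G_def)
    ultimately show "h (fst (Z n)) < h1" "h (snd (Z n)) < h1"
      using KT(4)[OF Zn(1)] KT(4)[OF Zn(2)] by (auto simp: less_le)
  qed
  obtain Zs r where Zs: "Zs \<in> K \<times> K" "strict_mono r" "(Z \<circ> r) \<longlonglongrightarrow> Zs"
    using compact_Times[OF K K] Z(1) unfolding compact_def by metis
  obtain xs ts ys ss where Zse: "Zs = ((xs, ts), (ys, ss))" by (metis prod.collapse)
  have lim: "(\<lambda>n. f (Z (r n))) \<longlonglongrightarrow> f Zs" if "continuous_on (K \<times> K) f" for f :: "_ \<Rightarrow> real"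
    using continuous_on_tendsto_compose[OF that Zs(3) Zs(1)] Z(1) by (auto simp: o_def)
  have "(\<lambda>n. (snd (fst (Z n)) - snd (snd (Z n)))\<^sup>2) \<longlonglongrightarrow> 0"
  proof (rule tendsto_sandwich[of "\<lambda>_. 0" _ _ "\<lambda>n. (Bw + Bv) * inverse (real (Suc n))"])
    show "\<forall>\<^sub>F n in sequentially. (snd (fst (Z n)) - snd (snd (Z n)))\<^sup>2 \<le> (Bw + Bv) * inverse (real (Suc n))"
      using tt by (auto intro!: always_eventually simp: field_simps)
    show "(\<lambda>n. (Bw + Bv) * inverse (real (Suc n))) \<longlonglongrightarrow> 0"
      by (rule tendsto_mult_right_zero[OF LIMSEQ_inverse_real_of_nat])
  qed auto
  from LIMSEQ_subseq_LIMSEQ[OF this Zs(2)]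
  have "(\<lambda>n. (snd (fst (Z (r n))) - snd (snd (Z (r n))))\<^sup>2) \<longlonglongrightarrow> 0" by (simp add: o_def)
  moreover have "(\<lambda>n. (snd (fst (Z (r n))) - snd (snd (Z (r n))))\<^sup>2) \<longlonglongrightarrow> (ts - ss)\<^sup>2"
    using lim[of "\<lambda>Z. (snd (fst Z) - snd (snd Z))\<^sup>2", OF continuous_on_subset[OF _ subset_UNIV]]
    by (simp add: Zse continuous_on_power continuous_on_diff continuous_on_fst continuous_on_snd continuous_on_id)
  ultimately have ss: "ss = ts" using LIMSEQ_unique by fastforce
  have zsK: "(xs, ts) \<in> K" "(ys, ts) \<in> K" using Zs(1) Zse ss by auto
  have lim2: "\<sigma> + L * smooth_norm e (xs - ys) \<le> w (xs, ts) - v (ys, ts)"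
  proof -
    define f where "f = (\<lambda>Z. w (fst Z) - v (snd Z) - L * smooth_norm e (fst (fst Z) - fst (snd Z)))"
    have "continuous_on (K \<times> K) (\<lambda>p. w (fst p))" "continuous_on (K \<times> K) (\<lambda>p. v (snd p))"
      by (rule continuous_on_compose2[OF wc] continuous_on_compose2[OF vc]; auto intro!: continuous_intros)+
    then have "continuous_on (K \<times> K) f" unfolding f_def smooth_norm_def by (intro continuous_intros)
    from lim[OF this] have "f Zs \<ge> \<sigma>"
      by (rule LIMSEQ_le_const) (use W\<sigma> in \<open>auto simp: f_def algebra_simps\<close>)
    then show ?thesis by (simp add: f_def Zse ss)
  qed
  have Ld: "L * dist xs ys \<le> L * smooth_norm e (xs - ys)"
    using L norm_le_smooth_norm[of "xs - ys" e] by (simp add: dist_norm)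
  have ts: "ts > 0"
  proof (rule ccontr)
    assume "\<not> ts > 0"
    then have "ts = 0" using KT[OF zsK(1)] by simp
    then show False using init[of xs ys] KT(4)[OF zsK(1)] KT(4)[OF zsK(2)] lim2 \<sigma> Ld
      by (simp add: w_def v_def)
  qed
  define Q where "Q = (\<lambda>Z::('a \<times> real) \<times> ('a \<times> real). L *\<^sub>R smooth_norm_grad e (fst (fst Z) - fst (snd Z)))"
  \<comment> \<open>What remains on adding the two viscosity inequalities at \<open>Z n\<close>: the
    derivatives of the time penalty cancel, so \<open>F\<close> does not depend on \<open>n\<close>
    and passes to the limit by continuity.\<close>
  define F where "F = (\<lambda>Z. (l * w (fst Z) + exp (- l * snd (fst Z)) *
       H (fst (fst Z)) (snd (fst Z)) (W (fst (fst Z)) (snd (fst Z))) (exp (l * snd (fst Z)) *\<^sub>R Q Z))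
     - (l * v (snd Z) + exp (- l * snd (snd Z)) *
       H (fst (snd Z)) (snd (snd Z)) (u (fst (snd Z)) (snd (snd Z))) (exp (l * snd (snd Z)) *\<^sub>R Q Z)))"
  have Fc: "continuous_on (K \<times> K) F"
  proof -
    have n0: "smooth_norm e z \<noteq> 0" for z :: 'a using smooth_norm_pos[of e z] e by simp
    have Qc: "continuous_on (K \<times> K) Q"
      unfolding Q_def smooth_norm_grad_def using n0
      by (intro continuous_intros) (auto simp: smooth_norm_def intro!: continuous_intros)
    have "continuous_on (K \<times> K) (\<lambda>Z. w (fst Z))" "continuous_on (K \<times> K) (\<lambda>Z. v (snd Z))"
      "continuous_on (K \<times> K) (\<lambda>Z. W (fst (fst Z)) (snd (fst Z)))"
      "continuous_on (K \<times> K) (\<lambda>Z. u (fst (snd Z)) (snd (snd Z)))"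
      by (rule continuous_on_compose2[OF wc] continuous_on_compose2[OF vc] continuous_on_compose2[OF Wk]
          continuous_on_compose2[OF uk]; auto intro!: continuous_intros)+
    then show ?thesis
      unfolding F_def using KT T1
      by (intro continuous_intros continuous_on_Hamiltonian[OF Hcont] Qc) (auto simp: less_imp_le)
  qed
  have Fle: "F (Z n) \<le> 0" if pos: "0 < snd (fst (Z n))" "0 < snd (snd (Z n))" for n
  proof -
    obtain x t y s where Ze: "Z n = ((x, t), (y, s))" by (metis prod.collapse)
    have in_K: "(x, t) \<in> K" "(y, s) \<in> K" using Z(1)[of n] Ze by auto
    have "open {z. h z < h1}" by (intro open_Collect_less hc continuous_intros)
    then have nbh: "\<exists>e>0. \<forall>z. dist z a < e \<longrightarrow> h z < h1" if "h a < h1" for a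
      using that unfolding open_dist by blast
    obtain e1 where e1: "e1 > 0" "\<And>z. dist z (x, t) < e1 \<Longrightarrow> h z < h1"
      using nbh[of "(x, t)"] Ghlt[of n] unfolding Ze by auto
    obtain e2 where e2: "e2 > 0" "\<And>z. dist z (y, s) < e2 \<Longrightarrow> h z < h1"
      using nbh[of "(y, s)"] Ghlt[of n] unfolding Ze by auto
    note e12 = e1 e2
    have max: "P n ((x', t'), (y', s')) \<le> P n ((x, t), (y, s))" if "(x', t') \<in> K" "(y', s') \<in> K" for x' t' y' s'
      using Z(2)[of "((x', t'), (y', s'))" n] that Ze by auto
    have tT: "0 < t" "t < T" "0 < s" "s < T" using pos Ze KT(3)[OF in_K(1)] KT(3)[OF in_K(2)] by auto
    have 1: "2 * real (Suc n) * (t - s) + l * (exp (- l * t) * W x t)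
      + exp (- l * t) * H x t (W x t) (exp (l * t) *\<^sub>R L *\<^sub>R smooth_norm_grad e (x - y)) \<le> 0"
    proof (rule subsolution_scaled_barrier[where l = l and x = x, OF sub C1_on_doubling_test[where e = e and L = L and y = y and c = "real (Suc n)" and s = s] h(1) G tT(1,2) h(2)[OF tT(1)] _ e12(1),
          simplified fst_conv snd_conv])
      show "e \<noteq> 0" using e by simp
      show "\<bar>H x t v p - H x t v q\<bar> \<le> (A2 * norm x + B2) * dist p q" for v p q using H2 tT by simp
      fix x' t' assume "0 < t'" "t' < T" "dist (x', t') (x, t) < e1"
      then have "(x', t') \<in> K" using e12(2)[of "(x', t')"] by (simp add: K_def)
      from max[OF this in_K(2)] 
      show "exp (- l * t') * W x' t' - (L * smooth_norm e (x' - y) + real (Suc n) * (t' - s)\<^sup>2) - G (h (x', t'))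
        \<le> exp (- l * t) * W x t - (L * smooth_norm e (x - y) + real (Suc n) * (t - s)\<^sup>2) - G (h (x, t))"
        by (simp add: P_def w_def v_def)
    qed
    have 2: "2 * real (Suc n) * (s - t) + l * (exp (- l * s) * (- u y s))
      + exp (- l * s) * - H y s (- (- u y s)) (- (exp (l * s) *\<^sub>R L *\<^sub>R smooth_norm_grad e (y - x))) \<le> 0"
    proof (rule subsolution_scaled_barrier[where l = l and x = y, OF super C1_on_doubling_test[where e = e and L = L and y = x and c = "real (Suc n)" and s = t] h(1) G tT(3,4) h(2)[OF tT(3)] _ e12(3),
          simplified fst_conv snd_conv])
      show "e \<noteq> 0" using e by simp
      show "\<bar>- H y s (- v) (- p) - (- H y s (- v) (- q))\<bar> \<le> (A2 * norm y + B2) * dist p q" for v p q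
        using H2[of s y "- v" "- p" "- q"] tT by (simp add: abs_minus_commute dist_norm norm_minus_commute)
      fix y' s' assume "0 < s'" "s' < T" "dist (y', s') (y, s) < e2"
      then have "(y', s') \<in> K" using e12(4)[of "(y', s')"] by (simp add: K_def)
      from max[OF in_K(1) this] 
      show "exp (- l * s') * - u y' s' - (L * smooth_norm e (y' - x) + real (Suc n) * (s' - t)\<^sup>2) - G (h (y', s'))
        \<le> exp (- l * s) * - u y s - (L * smooth_norm e (y - x) + real (Suc n) * (s - t)\<^sup>2) - G (h (y, s))"
        by (simp add: P_def w_def v_def smooth_norm_def power2_commute inner_diff inner_commute algebra_simps)
    qed
    have 3: "smooth_norm_grad e (y - x) = - smooth_norm_grad e (x - y)"
    proof -
      have "smooth_norm e (y - x) = smooth_norm e (x - y)"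
        by (simp add: smooth_norm_def flip: power2_norm_eq_inner) (simp add: norm_minus_commute)
      then show ?thesis by (simp add: smooth_norm_grad_def algebra_simps)
    qed
    show ?thesis using 1 2 unfolding 3 by (simp add: F_def Q_def Ze w_def v_def algebra_simps)
  qed
  have "\<forall>\<^sub>F n in sequentially. 0 < snd (fst (Z (r n)))" "\<forall>\<^sub>F n in sequentially. 0 < snd (snd (Z (r n)))"
    using order_tendstoD(1)[OF lim[of "\<lambda>Z. snd (fst Z)"], of 0] order_tendstoD(1)[OF lim[of "\<lambda>Z. snd (snd Z)"], of 0] ts ss
    by (simp_all add: Zse continuous_on_fst continuous_on_snd continuous_on_id)
  then have "\<forall>\<^sub>F n in sequentially. F (Z (r n)) \<le> 0"
    by eventually_elim (rule Fle)
  then have F0: "F Zs \<le> 0" by (rule tendsto_upperbound[OF lim[OF Fc]]) simp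
  define p where "p = exp (l * ts) *\<^sub>R Q Zs"
  have tsT: "ts \<in> {0..T}" using KT[OF zsK(1)] by simp
  have Qn: "norm (Q Zs) \<le> L"
    using norm_smooth_norm_grad[of e "xs - ys"] e L by (simp add: Q_def Zse)
  have ee: "exp (- l * ts) * exp (l * ts) = 1" by (simp flip: exp_add)
  have wv: "w (xs, ts) - v (ys, ts) > 0" 
    using lim2 \<sigma> Ld L by (smt (verit) mult_nonneg_nonneg zero_le_dist)
  have Wu: "W xs ts - u ys ts = exp (l * ts) * (w (xs, ts) - v (ys, ts))"
    using ee by (simp add: w_def v_def algebra_simps)
  have "H ys ts (u ys ts) p - H xs ts (W xs ts) p \<le> K3 * \<bar>W xs ts - u ys ts\<bar> + C * (1 + norm p) * dist xs ys"
    using H1(2)[OF tsT, of xs "W xs ts" p ys] H3[OF tsT, of ys "W xs ts" p "u ys ts"] by linarith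
  then have "exp (- l * ts) * (H ys ts (u ys ts) p - H xs ts (W xs ts) p)
    \<le> exp (- l * ts) * (K3 * \<bar>W xs ts - u ys ts\<bar> + C * (1 + norm p) * dist xs ys)"
    by (rule mult_left_mono) simp
  also have "\<dots> = K3 * (w (xs, ts) - v (ys, ts)) + C * (exp (- l * ts) + norm (Q Zs)) * dist xs ys"
  proof -
    have "\<bar>W xs ts - u ys ts\<bar> = exp (l * ts) * (w (xs, ts) - v (ys, ts))" using wv unfolding Wu by simp
    moreover have "norm p = exp (l * ts) * norm (Q Zs)" by (simp add: p_def)
    moreover have "e1 * (K3 * (e2 * a) + C * (1 + e2 * b) * c) = (e1 * e2) * (K3 * a) + C * (e1 + (e1 * e2) * b) * c"
      for e1 e2 a b c :: real by (simp add: algebra_simps)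
    ultimately show ?thesis using ee by (metis mult_1)
  qed
  also have "\<dots> \<le> K3 * (w (xs, ts) - v (ys, ts)) + C * (1 + L) * dist xs ys"
  proof -
    have "l * ts \<ge> 0" using ts H1(1) K3 by (simp add: l_def)
    then have "exp (- l * ts) + norm (Q Zs) \<le> 1 + L" using Qn by (intro add_mono) auto
    then show ?thesis using H1(1) by (intro add_left_mono mult_right_mono mult_left_mono) auto
  qed
  also have "\<dots> \<le> K3 * (w (xs, ts) - v (ys, ts)) + 2 * C * (w (xs, ts) - v (ys, ts))"
  proof -
    have "(1 + L) * dist xs ys \<le> (2 * L) * dist xs ys" using L by (intro mult_right_mono) auto
    also have "\<dots> \<le> 2 * (w (xs, ts) - v (ys, ts))" using lim2 \<sigma> Ld by simp
    finally have "C * ((1 + L) * dist xs ys) \<le> C * (2 * (w (xs, ts) - v (ys, ts)))"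
      using H1(1) by (rule mult_left_mono)
    then show ?thesis by (simp add: mult.assoc mult.left_commute)
  qed
  finally have "l * (w (xs, ts) - v (ys, ts)) \<le> K3 * (w (xs, ts) - v (ys, ts)) + 2 * C * (w (xs, ts) - v (ys, ts))"
    using F0 by (simp add: F_def Zse ss p_def[symmetric] algebra_simps) (simp add: p_def Zse ss algebra_simps)
  then show False using wv by (simp add: l_def algebra_simps)
qed

text \<open>Only times near the touching point matter, so the neighbourhood is shrunk to stay below
  \<open>T'\<close>. Needed because \<open>m\<close> is known to be nonnegative only until slightly
  after the target time.\<close>

lemma subsolution_restrict:
  assumes "subsolution T H W" "T' \<le> T"
  shows "subsolution T' H W"
  unfolding subsolution_def
proof (intro allI impI)
  fix \<phi> g x t
  assume C: "C1_on UNIV \<phi> g" "0 < t" "t < T'"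
    and "\<exists>e>0. \<forall>y s. 0 < s \<and> s < T' \<and> dist (y, s) (x, t) < e \<longrightarrow> W y s - \<phi> (y, s) \<le> W x t - \<phi> (x, t)"
  then obtain e where e: "e > 0"
    "\<And>y s. 0 < s \<Longrightarrow> s < T' \<Longrightarrow> dist (y, s) (x, t) < e \<Longrightarrow> W y s - \<phi> (y, s) \<le> W x t - \<phi> (x, t)" by blast
  show "snd (g (x, t)) + H x t (W x t) (fst (g (x, t))) \<le> 0"
  proof (rule subsolutionD[OF assms(1) C(1,2), of "min e (T' - t)"])
    fix y s assume h: "0 < s" "dist (y, s) (x, t) < min e (T' - t)"
    have "dist s t \<le> dist (y, s) (x, t)" using dist_snd_le[of "(y, s)" "(x, t)"] by simp
    then show "W y s - \<phi> (y, s) \<le> W x t - \<phi> (x, t)" using h by (intro e(2)) (auto simp: dist_real_def)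
  qed (use e C assms in auto)
qed

text \<open>The integral of \<open>exp (A * s)\<close> over \<open>0 \<le> s \<le> t\<close>. The
  solution of \<open>d' = A * d + (A * norm x + B)\<close> with \<open>d 0 = 0\<close>, the distance
  reached from \<open>x\<close> at maximal speed, is
  \<open>(A * norm x + B) * cone_time A t\<close>; this is \<open>Rfun\<close>, with its two cases
  in one.\<close>

definition cone_time :: "real \<Rightarrow> real \<Rightarrow> real" where
  "cone_time A t = (if A = 0 then t else (exp (A * t) - 1) / A)"

lemma cone_time_deriv: "(cone_time A has_real_derivative exp (A * t)) (at t)"
  unfolding cone_time_def by (cases "A = 0") (auto intro!: derivative_eq_intros)

lemma cone_time_0 [simp]: "cone_time A 0 = 0"
  unfolding cone_time_def by simp

lemma cone_time_nonneg: "A \<ge> 0 \<Longrightarrow> t \<ge> 0 \<Longrightarrow> cone_time A t \<ge> 0"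
  unfolding cone_time_def by auto

text \<open>The sublevel sets of \<open>h\<close> are truncated dependence cones: their lateral boundary moves at least
  at the maximal propagation speed \<open>A * norm x + B\<close>, and a penalty in time closes them before \<open>T1\<close>.\<close>

lemma cone_function:
  fixes xh :: "'a::euclidean_space"
  assumes AB: "A \<ge> 0" "B \<ge> 0" and t: "0 \<le> th" "th < T1" and h1: "h1 \<ge> 0" and \<nu>: "\<nu> > 0"
  obtains h k where "C1_on UNIV h k"
    "\<And>x t. 0 < t \<Longrightarrow> (A * norm x + B) * norm (fst (k (x, t))) \<le> snd (k (x, t))"
    "bounded {z. 0 \<le> snd z \<and> h z \<le> h1}" "\<And>z. h z \<le> h1 \<Longrightarrow> snd z \<le> T1"
    "\<And>x t. t \<le> th \<Longrightarrow> h (x, t) = exp (A * t) * smooth_norm \<nu> (x - xh) + (A * norm xh + B) * cone_time A t"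
proof -
  \<comment> \<open>With this factor the time penalty reaches \<open>h1 + 1\<close> at
    \<open>T1\<close>, above the level \<open>h1\<close>.\<close>
  define D where "D = (h1 + 1) / (T1 - th)\<^sup>2"
  have D: "D > 0" "D * (T1 - th)\<^sup>2 = h1 + 1" using t h1 by (auto simp: D_def)
  define h where "h = (\<lambda>z::'a \<times> real. exp (A * snd z) * smooth_norm \<nu> (fst z - xh)
     + ((A * norm xh + B) * cone_time A (snd z) + D * (max 0 (snd z - th))\<^sup>2))"
  define k where "k = (\<lambda>z::'a \<times> real. (exp (A * snd z) *\<^sub>R (smooth_norm_grad \<nu> (fst z - xh), 0::real)
      + smooth_norm \<nu> (fst z - xh) *\<^sub>R (0, A * exp (A * snd z)))
     + (0, (A * norm xh + B) * exp (A * snd z) + D * (2 * max 0 (snd z - th))))"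
  have 1: "C1_on UNIV h k"
    unfolding h_def k_def using \<nu>
    by (intro C1_on_add C1_on_mult C1_on_const C1_on_fst[OF C1_on_smooth_norm]
        C1_on_snd[where k = "\<lambda>s. exp (A * s)"]
        C1_on_snd[where k = "\<lambda>s. (A * norm xh + B) * cone_time A s + D * (max 0 (s - th))\<^sup>2"])
      (auto intro!: DERIV_add DERIV_cmult cone_time_deriv has_real_derivative_pos_part_square continuous_intros
        DERIV_fun_exp[THEN DERIV_cong, OF DERIV_cmult_Id])
  have 2: "(A * norm x + B) * norm (fst (k (x, t))) \<le> snd (k (x, t))" for x t
  proof -
    \<comment> \<open>The speed at \<open>x\<close> splits into a part due to the distance from
      \<open>xh\<close>, paid by differentiating \<open>exp (A * t)\<close>, and the speed at
      \<open>xh\<close>, paid by \<open>cone_time\<close>.\<close>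
    have "A * norm x + B \<le> A * smooth_norm \<nu> (x - xh) + (A * norm xh + B)"
    proof -
      have "norm x \<le> smooth_norm \<nu> (x - xh) + norm xh"
        using norm_triangle_ineq[of "x - xh" xh] norm_le_smooth_norm[of "x - xh" \<nu>] by simp
      then have "A * norm x \<le> A * (smooth_norm \<nu> (x - xh) + norm xh)" using AB by (intro mult_left_mono)
      then show ?thesis by (simp add: algebra_simps)
    qed
    then have "(A * norm x + B) * exp (A * t) \<le> (A * smooth_norm \<nu> (x - xh) + (A * norm xh + B)) * exp (A * t)"
      by (rule mult_right_mono) simp
    moreover have "(A * norm x + B) * norm (fst (k (x, t))) \<le> (A * norm x + B) * exp (A * t)"
      using AB norm_smooth_norm_grad[of \<nu> "x - xh"] \<nu> by (intro mult_left_mono) (auto simp: k_def)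
    moreover have "D * (2 * max 0 (t - th)) \<ge> 0" using D by simp
    ultimately show ?thesis by (simp add: k_def algebra_simps)
  qed
  have pos: "exp (A * snd z) * smooth_norm \<nu> (fst z - xh) \<ge> 0" "D * (max 0 (snd z - th))\<^sup>2 \<ge> 0" for z
    using smooth_norm_pos[of \<nu> "fst z - xh"] \<nu> D(1) by auto
  have posJ: "(A * norm xh + B) * cone_time A (snd z) \<ge> 0" if "0 \<le> snd z" for z :: "'a \<times> real"
    using AB cone_time_nonneg[OF AB(1) that] by simp
  have 4: "snd z \<le> T1" if "h z \<le> h1" for z
  proof (rule ccontr)
    assume n: "\<not> snd z \<le> T1"
    then have "(T1 - th)\<^sup>2 \<le> (max 0 (snd z - th))\<^sup>2" using t by (intro power_mono) auto
    then have "D * (T1 - th)\<^sup>2 \<le> D * (max 0 (snd z - th))\<^sup>2" using D(1) by simp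
    then show False using that pos[of z] posJ[of z] n t D by (simp add: h_def)
  qed
  have 3: "bounded {z. 0 \<le> snd z \<and> h z \<le> h1}"
  proof (rule bounded_subset[of "cball xh h1 \<times> {0..T1}"])
    show "bounded (cball xh h1 \<times> {0..T1})" by (intro bounded_Times bounded_cball) auto
    show "{z. 0 \<le> snd z \<and> h z \<le> h1} \<subseteq> cball xh h1 \<times> {0..T1}"
    proof
      fix z assume "z \<in> {z. 0 \<le> snd z \<and> h z \<le> h1}"
      then have z: "0 \<le> snd z" "h z \<le> h1" by auto
      have "norm (fst z - xh) \<le> smooth_norm \<nu> (fst z - xh)" by (rule norm_le_smooth_norm)
      also have "\<dots> \<le> exp (A * snd z) * smooth_norm \<nu> (fst z - xh)"
        using smooth_norm_pos[of \<nu> "fst z - xh"] \<nu> z AB by simp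
      also have "\<dots> \<le> h1" using z pos(2)[of z] posJ[of z] by (simp add: h_def)
      finally show "z \<in> cball xh h1 \<times> {0..T1}"
        using z 4[of z] by (cases z) (simp add: dist_norm norm_minus_commute)
    qed
  qed
  show ?thesis
    by (rule that[OF 1 2 3 4]) (auto simp: h_def)
qed

text \<open>The sublevel set of the cone function at level \<open>\<rho>\<close> meets time 0 inside
  the ball of radius \<open>\<rho>\<close>, so only initial values there matter. For
  \<open>y = xh\<close> the condition on \<open>\<rho>\<close> says that it exceeds
  \<open>Rfun\<close>, which explains the shape of \<open>Eset\<close>.\<close>

lemma cone_comparison:
  fixes W u :: "'a::euclidean_space \<Rightarrow> real \<Rightarrow> real"
  assumes th: "0 \<le> th" "th < T" and AB: "A2 \<ge> 0" "B2 \<ge> 0"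
    and Hcont: "continuous_on (UNIV \<times> {0..T} \<times> UNIV \<times> UNIV) (\<lambda>(x, t, v, p). H x t v p)"
    and H1: "C \<ge> 0" "\<And>x y t v p. t \<in> {0..T} \<Longrightarrow> \<bar>H x t v p - H y t v p\<bar> \<le> C * (1 + norm p) * dist x y"
    and H2: "\<And>x t v p q. t \<in> {0..T} \<Longrightarrow> \<bar>H x t v p - H x t v q\<bar> \<le> (A2 * norm x + B2) * dist p q"
    and K3: "K3 \<ge> 0"
    and H3: "\<And>x t v w p. t \<in> {0..T} \<Longrightarrow> \<bar>H x t v p - H x t w p\<bar> \<le> K3 * \<bar>v - w\<bar>"
    and sub: "subsolution T H W"
    and super: "subsolution T (\<lambda>x t v p. - H x t (- v) (- p)) (\<lambda>x t. - u x t)"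
    and Wc: "continuous_on (UNIV \<times> {0..<T}) (\<lambda>(x, t). W x t)"
    and uc: "continuous_on (UNIV \<times> {0..<T}) (\<lambda>(x, t). u x t)"
    and \<rho>: "exp (A2 * th) * dist y xh + (A2 * norm xh + B2) * cone_time A2 th < \<rho>"
    and L: "L \<ge> 1"
    and init: "\<And>x y. dist x xh \<le> \<rho> \<Longrightarrow> dist y xh \<le> \<rho> \<Longrightarrow> W x 0 - u y 0 \<le> L * dist x y"
  shows "W xh th - u y th \<le> exp ((K3 + 2 * C + 1) * th) * (L * dist xh y)"
proof -
  define \<rho>0 where "\<rho>0 = exp (A2 * th) * dist y xh + (A2 * norm xh + B2) * cone_time A2 th"
  \<comment> \<open>Smoothing the norm uses half of the gap between \<open>\<rho>0\<close> and
    \<open>\<rho>\<close>; the other half separates the two levels \<open>h0 < h1\<close> required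
    by \<open>comparison\<close>.\<close>
  define \<nu> where "\<nu> = (\<rho> - \<rho>0) / (2 * exp (A2 * th))"
  have \<rho>0: "\<rho>0 < \<rho>" "\<rho>0 \<ge> 0" using \<rho> AB cone_time_nonneg[OF AB(1) th(1)] by (auto simp: \<rho>0_def)
  then have \<nu>: "\<nu> > 0" by (simp add: \<nu>_def)
  have e\<nu>: "exp (A2 * th) * \<nu> = (\<rho> - \<rho>0) / 2" by (simp add: \<nu>_def)
  define T1 where "T1 = (th + T) / 2"
  have T1: "th < T1" "T1 < T" using th by (auto simp: T1_def)
  show ?thesis
  proof (rule cone_function[OF AB th(1) T1(1) order.strict_implies_order[OF order.strict_trans1[OF \<rho>0(2,1)]] \<nu>, of xh])
    fix h :: "'a \<times> real \<Rightarrow> real" and k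
    assume h: "C1_on UNIV h k"
      "\<And>x t. 0 < t \<Longrightarrow> (A2 * norm x + B2) * norm (fst (k (x, t))) \<le> snd (k (x, t))"
      "bounded {z. 0 \<le> snd z \<and> h z \<le> \<rho>}" "\<And>z. h z \<le> \<rho> \<Longrightarrow> snd z \<le> T1"
      "\<And>x t. t \<le> th \<Longrightarrow> h (x, t) = exp (A2 * t) * smooth_norm \<nu> (x - xh) + (A2 * norm xh + B2) * cone_time A2 t"
    have le: "h (x, th) \<le> (\<rho> + \<rho>0) / 2" if "dist x xh \<le> dist y xh" for x
    proof -
      have "exp (A2 * th) * smooth_norm \<nu> (x - xh) \<le> exp (A2 * th) * (dist y xh + \<nu>)"
        using smooth_norm_le[of \<nu> "x - xh"] that \<nu> by (intro mult_left_mono) (auto simp: dist_norm)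
      then show ?thesis using e\<nu> by (simp add: h(5) \<rho>0_def algebra_simps)
    qed
    have h0: "dist x xh \<le> \<rho>" if "h (x, 0) \<le> \<rho>" for x
      using norm_le_smooth_norm[of "x - xh" \<nu>] that th h(5)[of 0 x]
      by (simp add: dist_norm)
    show ?thesis
      by (rule comparison[where ?h0.0 = "(\<rho> + \<rho>0) / 2", OF T1(2) Hcont H1 H2 K3 H3 sub super Wc uc h(1-4) _ L init le le th(1)])
        (use h0 \<rho>0 in auto)
  qed
qed

subsection \<open>Minima over moving balls\<close>

text \<open>An affine minorant \<open>a \<bullet> q - c\<close> of the Hamiltonian turns the equation into a transport inequality,
  whose viscosity subsolutions grow at rate at most \<open>c\<close> along lines of velocity \<open>a\<close>. Only \<open>norm q \<le> 2 * N\<close>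
  matters because \<open>u\<close> is \<open>N\<close>-Lipschitz in space.\<close>

lemma line_decrease:
  fixes u :: "'a::euclidean_space \<Rightarrow> real \<Rightarrow> real"
  assumes sub: "subsolution T H u" and uc: "continuous_on (UNIV \<times> {0..<T}) (\<lambda>(x, t). u x t)"
    and N: "N \<ge> 0" and Lip: "\<And>x y t. 0 \<le> t \<Longrightarrow> t < T \<Longrightarrow> \<bar>u x t - u y t\<bar> \<le> N * dist x y"
    and t: "0 \<le> t0" "t0 < t1" "t1 < t2" "t2 < T" and \<eta>: "\<eta> > 0"
    and Hle: "\<And>s y q. t0 \<le> s \<Longrightarrow> s \<le> t2 \<Longrightarrow> dist y (y0 + (s - t0) *\<^sub>R a) < \<eta> \<Longrightarrow> norm q \<le> 2 * N \<Longrightarrow>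
      H y s (u y s) q \<ge> a \<bullet> q - c"
  shows "u (y0 + (t1 - t0) *\<^sub>R a) t1 \<le> u y0 t0 + c * (t1 - t0)"
proof (rule ccontr)
  define X where "X = (\<lambda>s. y0 + (s - t0) *\<^sub>R a)"
  define \<sigma> where "\<sigma> = u (X t1) t1 - u y0 t0 - c * (t1 - t0)"
  assume "\<not> ?thesis"
  then have \<sigma>: "\<sigma> > 0" by (simp add: \<sigma>_def X_def)
  \<comment> \<open>Half of the excess raises the slope above \<open>c\<close>, which makes the
    final inequality strict; \<open>\<sigma> / 2\<close> is left at
    \<open>(X t1, t1)\<close>.\<close>
  define b where "b = c + \<sigma> / (2 * (t1 - t0))"
  have b: "b > c" "b * (t1 - t0) = c * (t1 - t0) + \<sigma> / 2" using \<sigma> t by (auto simp: b_def field_simps)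
  \<comment> \<open>The transverse penalty holds the maximum within \<open>N * \<epsilon>\<close> of
    the line, so its gradient there has norm at most \<open>2 * N\<close>. The first bound limits
    the loss of height in moving to the line to \<open>\<sigma> / 4\<close>; the second keeps the
    maximum inside the tube of radius \<open>\<eta>\<close>.\<close>
  define \<epsilon> where "\<epsilon> = min (\<sigma> / (4 * (N\<^sup>2 + 1))) (\<eta> / (2 * (N + 1)))"
  have N2: "N\<^sup>2 + 1 > 0" by (simp add: add_nonneg_pos)
  have \<epsilon>: "\<epsilon> > 0" "N\<^sup>2 * \<epsilon> \<le> \<sigma> / 4" "N * \<epsilon> < \<eta>"
  proof -
    show e: "\<epsilon> > 0" using \<sigma> \<eta> N N2 by (auto simp: \<epsilon>_def)
    have "N\<^sup>2 * \<epsilon> \<le> (N\<^sup>2 + 1) * \<epsilon>" using e by simp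
    also have "\<dots> \<le> (N\<^sup>2 + 1) * (\<sigma> / (4 * (N\<^sup>2 + 1)))"
      using N2 by (intro mult_left_mono) (auto simp: \<epsilon>_def)
    also have "\<dots> = \<sigma> / 4" using N2 by (simp add: field_simps)
    finally show "N\<^sup>2 * \<epsilon> \<le> \<sigma> / 4" .
    have "N * \<epsilon> \<le> (N + 1) * \<epsilon>" using e by simp
    also have "\<dots> \<le> (N + 1) * (\<eta> / (2 * (N + 1)))"
      using N by (intro mult_left_mono) (auto simp: \<epsilon>_def)
    also have "\<dots> = \<eta> / 2" using N by (simp add: field_simps)
    finally show "N * \<epsilon> < \<eta>" using \<eta> by simp
  qed
  \<comment> \<open>The penalty after \<open>t1\<close> is scaled to cancel any gain of
    \<open>u\<close> along the line up to \<open>t2\<close>, so the maximum is not attained at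
    \<open>t2\<close>. This is the reason for allowing room beyond \<open>t1\<close>.\<close>
  define D where "D = (\<bar>u (X t2) t2 - b * (t2 - t0) - u y0 t0\<bar>) / (t2 - t1)\<^sup>2"
  have D: "D \<ge> 0" "D * (t2 - t1)\<^sup>2 = \<bar>u (X t2) t2 - b * (t2 - t0) - u y0 t0\<bar>" using t by (auto simp: D_def)
  define \<phi> where "\<phi> = (\<lambda>z::'a \<times> real. (b * (snd z - t0) + D * (max 0 (snd z - t1))\<^sup>2)
     + (1 / \<epsilon>) * ((fst z - X (snd z)) \<bullet> (fst z - X (snd z))))"
  define g where "g = (\<lambda>z::'a \<times> real. (0::'a, b + D * (2 * max 0 (snd z - t1)))
     + ((1 / \<epsilon>) *\<^sub>R (2 *\<^sub>R (fst z - X (snd z)), - 2 * ((fst z - X (snd z)) \<bullet> a)) + ((fst z - X (snd z)) \<bullet> (fst z - X (snd z))) *\<^sub>R 0))"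
  have C: "C1_on UNIV \<phi> g"
  proof -
    have lin: "((\<lambda>s. b * (s - t0)) has_real_derivative b) (at r)" for r
      by (auto intro!: derivative_eq_intros)
    have 1: "C1_on UNIV (\<lambda>z::'a \<times> real. b * (snd z - t0) + D * (max 0 (snd z - t1))\<^sup>2) (\<lambda>z. (0, b + D * (2 * max 0 (snd z - t1))))"
      by (rule C1_on_snd[where k = "\<lambda>s. b * (s - t0) + D * (max 0 (s - t1))\<^sup>2"])
        (auto intro!: DERIV_add DERIV_cmult has_real_derivative_pos_part_square continuous_intros lin)
    have 2: "C1_on UNIV (\<lambda>z::'a \<times> real. (fst z - X (snd z)) \<bullet> (fst z - X (snd z)))
      (\<lambda>z. (2 *\<^sub>R (fst z - X (snd z)), - 2 * ((fst z - X (snd z)) \<bullet> a)))"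
      unfolding C1_on_def
    proof (intro conjI ballI)
      fix z :: "'a \<times> real"
      have "((\<lambda>z::'a \<times> real. fst z - X (snd z)) has_derivative (\<lambda>h. fst h - snd h *\<^sub>R a)) (at z)"
        unfolding X_def by (auto intro!: derivative_eq_intros)
      from has_derivative_inner[OF this this]
      show "((\<lambda>z::'a \<times> real. (fst z - X (snd z)) \<bullet> (fst z - X (snd z))) has_derivative
        (\<lambda>h. (2 *\<^sub>R (fst z - X (snd z)), - 2 * ((fst z - X (snd z)) \<bullet> a)) \<bullet> h)) (at z)"
        by (rule has_derivative_eq_rhs) (auto simp: fun_eq_iff inner_prod_def inner_diff_right inner_diff_left inner_commute algebra_simps)
    qed (auto intro!: continuous_intros simp: X_def)
    show ?thesis unfolding \<phi>_def g_def by (intro C1_on_add C1_on_mult C1_on_const 1 2)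
  qed
  define S where "S = {z::'a \<times> real. t0 \<le> snd z \<and> snd z \<le> t2 \<and> dist (fst z) (X (snd z)) \<le> \<eta>}"
  have Xc: "continuous_on A (\<lambda>z. X (f z))" if "continuous_on A f" for A and f :: "'a \<times> real \<Rightarrow> real"
    unfolding X_def by (intro continuous_intros that)
  have "compact S"
  proof -
    have "closed S" unfolding S_def
      by (intro closed_Collect_conj closed_Collect_le continuous_intros Xc)
    moreover have "S \<subseteq> cball y0 (\<eta> + norm a * (t2 - t0)) \<times> {t0..t2}"
    proof
      fix z assume z: "z \<in> S"
      then have "dist y0 (fst z) \<le> dist (X (snd z)) (fst z) + dist y0 (X (snd z))"
        by (metis add.commute dist_triangle)
      moreover have "dist y0 (X (snd z)) = norm a * (snd z - t0)" using z by (simp add: X_def dist_norm S_def)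
      moreover have "norm a * (snd z - t0) \<le> norm a * (t2 - t0)" using z by (intro mult_left_mono) (auto simp: S_def)
      ultimately show "z \<in> cball y0 (\<eta> + norm a * (t2 - t0)) \<times> {t0..t2}"
        using z by (cases z) (auto simp: S_def dist_commute)
    qed
    moreover have "bounded (cball y0 (\<eta> + norm a * (t2 - t0)) \<times> {t0..t2})" by (intro bounded_Times) auto
    ultimately show ?thesis using bounded_subset compact_eq_bounded_closed by blast
  qed
  moreover have "continuous_on S (\<lambda>z. u (fst z) (snd z) - \<phi> z)"
  proof -
    have "continuous_on S (\<lambda>z. u (fst z) (snd z))"
      using continuous_on_subset[OF uc, of S] t by (force simp: case_prod_unfold S_def)
    then show ?thesis using continuous_on_subset[OF C1_on_imp_continuous[OF C]] by (intro continuous_intros) auto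
  qed
  moreover have X1: "(X t1, t1) \<in> S" using t \<eta> by (simp add: S_def)
  ultimately obtain z where z: "z \<in> S" "\<And>z'. z' \<in> S \<Longrightarrow> u (fst z') (snd z') - \<phi> z' \<le> u (fst z) (snd z) - \<phi> z"
    using continuous_attains_sup[of S "\<lambda>z. u (fst z) (snd z) - \<phi> z"] by blast
  obtain y s where ys: "z = (y, s)" by (cases z)
  have s: "t0 \<le> s" "s \<le> t2" "dist y (X s) \<le> \<eta>" using z ys by (auto simp: S_def)
  have phi: "\<phi> (y, s) = b * (s - t0) + D * (max 0 (s - t1))\<^sup>2 + (dist y (X s))\<^sup>2 / \<epsilon>"
    by (simp add: \<phi>_def dist_norm power2_norm_eq_inner)
  have big: "u y0 t0 + \<sigma> / 2 \<le> u y s - \<phi> (y, s)"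
  proof -
    have "\<phi> (X t1, t1) = b * (t1 - t0)" by (simp add: \<phi>_def)
    moreover have "u (X t1) t1 = u y0 t0 + c * (t1 - t0) + \<sigma>" by (simp add: \<sigma>_def)
    ultimately show ?thesis using z(2)[OF X1] b by (simp add: ys)
  qed
  have d\<epsilon>: "dist y (X s) \<le> N * \<epsilon>"
  proof -
    have "(X s, s) \<in> S" using s \<eta> by (simp add: S_def)
    from z(2)[OF this] have "(dist y (X s))\<^sup>2 / \<epsilon> \<le> u y s - u (X s) s"
      by (simp add: ys phi) (simp add: \<phi>_def)
    also have "\<dots> \<le> N * dist y (X s)" using Lip[of s y "X s"] s t by auto
    finally have *: "dist y (X s) * dist y (X s) \<le> (N * \<epsilon>) * dist y (X s)"
      using \<epsilon> by (simp add: field_simps power2_eq_square)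
    show ?thesis
    proof (cases "dist y (X s) = 0")
      case False
      then show ?thesis using * by (metis mult_right_le_imp_le zero_less_dist_iff dist_eq_0_iff)
    qed (use N \<epsilon> in simp)
  qed
  have uX: "u y s \<le> u (X s) s + \<sigma> / 4"
  proof -
    have "N * dist y (X s) \<le> N * (N * \<epsilon>)" using d\<epsilon> N by (rule mult_left_mono)
    then show ?thesis using Lip[of s y "X s"] s t \<epsilon> by (auto simp: power2_eq_square mult.assoc abs_le_iff)
  qed
  have d0: "(dist y (X s))\<^sup>2 / \<epsilon> \<ge> 0" using \<epsilon> by simp
  \<comment> \<open>Both end times give at most \<open>u y0 t0 + \<sigma> / 4\<close>, less than the
    value in \<open>big\<close>.\<close>
  have "s \<noteq> t0" using big uX phi d0 t \<sigma> by (auto simp: X_def)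
  moreover have "s \<noteq> t2"
  proof
    assume "s = t2"
    then have "\<phi> (y, s) \<ge> b * (t2 - t0) + \<bar>u (X t2) t2 - b * (t2 - t0) - u y0 t0\<bar>"
      using phi d0 t D by simp
    then show False using big uX \<sigma> unfolding \<open>s = t2\<close> by linarith
  qed
  ultimately have st: "t0 < s" "s < t2" using s by auto
  have "open {z::'a \<times> real. t0 < snd z \<and> snd z < t2 \<and> dist (fst z) (X (snd z)) < \<eta>}"
    by (intro open_Collect_conj open_Collect_less continuous_intros Xc)
  then obtain e where e: "e > 0" "\<And>z. dist z (y, s) < e \<Longrightarrow> z \<in> S"
    unfolding open_dist S_def using st d\<epsilon> \<epsilon> by fastforce
  have sub': "snd (g (y, s)) + H y s (u y s) (fst (g (y, s))) \<le> 0"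
  proof (rule subsolutionD[OF sub C _ _ e(1)])
    fix y' s' assume "dist (y', s') (y, s) < e"
    from z(2)[OF e(2)[OF this]] show "u y' s' - \<phi> (y', s') \<le> u y s - \<phi> (y, s)" by (simp add: ys)
  qed (use st t in auto)
  define q where "q = (2 / \<epsilon>) *\<^sub>R (y - X s)"
  have q: "fst (g (y, s)) = q" "snd (g (y, s)) = b + D * (2 * max 0 (s - t1)) - a \<bullet> q"
    by (auto simp: g_def q_def inner_commute)
  have "norm q \<le> 2 * N"
    using d\<epsilon> \<epsilon>(1) unfolding q_def norm_scaleR by (simp add: dist_norm field_simps)
  then have "a \<bullet> q - c \<le> H y s (u y s) q"
    using st d\<epsilon> \<epsilon> by (intro Hle) (auto simp: X_def)
  moreover have "D * (2 * max 0 (s - t1)) \<ge> 0" using D by simp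
  ultimately show False using sub' b unfolding q by linarith
qed

text \<open>Parametrised by the fixed unit ball, so that the minimum runs over a compact set
  independent of \<open>(x, t)\<close>, which is what continuity in \<open>(x, t)\<close> rests
  on.\<close>

definition ball_min :: "(real \<Rightarrow> real) \<Rightarrow> (real \<Rightarrow> real) \<Rightarrow> ('a::euclidean_space \<Rightarrow> real \<Rightarrow> real) \<Rightarrow> 'a \<Rightarrow> real \<Rightarrow> real" where
  "ball_min \<rho> m u x t = Inf ((\<lambda>w. u (x + \<rho> t *\<^sub>R w) t) ` cball 0 1) + m t"

lemma ball_min_attained:
  fixes u :: "'a::euclidean_space \<Rightarrow> real \<Rightarrow> real"
  assumes uc: "continuous_on UNIV (\<lambda>x. u x t)"
  obtains w where "norm w \<le> 1" "ball_min \<rho> m u x t = u (x + \<rho> t *\<^sub>R w) t + m t"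
    "\<And>w'. norm w' \<le> 1 \<Longrightarrow> u (x + \<rho> t *\<^sub>R w) t \<le> u (x + \<rho> t *\<^sub>R w') t"
proof -
  have "continuous_on (cball 0 1) (\<lambda>w. u (x + \<rho> t *\<^sub>R w) t)"
    by (rule continuous_on_compose2[OF uc]) (auto intro!: continuous_intros)
  from continuous_attains_inf[OF compact_cball _ this]
  obtain w where w: "norm w \<le> 1" "\<And>w'. norm w' \<le> 1 \<Longrightarrow> u (x + \<rho> t *\<^sub>R w) t \<le> u (x + \<rho> t *\<^sub>R w') t" by auto
  then have "Inf ((\<lambda>w. u (x + \<rho> t *\<^sub>R w) t) ` cball 0 1) = u (x + \<rho> t *\<^sub>R w) t"
    by (intro cInf_eq_minimum) auto
  then show ?thesis using that w by (simp add: ball_min_def)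
qed

lemma ball_min_le:
  fixes u :: "'a::euclidean_space \<Rightarrow> real \<Rightarrow> real"
  assumes uc: "continuous_on UNIV (\<lambda>x. u x t)" and "\<rho> t > 0" "dist y x \<le> \<rho> t"
  shows "ball_min \<rho> m u x t \<le> u y t + m t"
proof -
  obtain w where w: "ball_min \<rho> m u x t = u (x + \<rho> t *\<^sub>R w) t + m t"
    "\<And>w'. norm w' \<le> 1 \<Longrightarrow> u (x + \<rho> t *\<^sub>R w) t \<le> u (x + \<rho> t *\<^sub>R w') t"
    using ball_min_attained[of u t \<rho> m x] uc by metis
  have "y = x + \<rho> t *\<^sub>R ((1 / \<rho> t) *\<^sub>R (y - x))" using assms by simp
  moreover have "norm ((1 / \<rho> t) *\<^sub>R (y - x)) \<le> 1" using assms(2,3) unfolding norm_scaleR by (simp add: dist_norm)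
  ultimately show ?thesis using w by (metis add_right_mono)
qed

lemma ball_min_point:
  fixes u :: "'a::euclidean_space \<Rightarrow> real \<Rightarrow> real"
  assumes uc: "continuous_on UNIV (\<lambda>x. u x t)" and "\<rho> t > 0"
  obtains y where "dist y x \<le> \<rho> t" "ball_min \<rho> m u x t = u y t + m t"
proof -
  obtain w where w: "norm w \<le> 1" "ball_min \<rho> m u x t = u (x + \<rho> t *\<^sub>R w) t + m t"
    using ball_min_attained[of u t \<rho> m x] uc by metis
  have "dist (x + \<rho> t *\<^sub>R w) x \<le> \<rho> t" using w assms(2) by (simp add: dist_norm mult_left_le)
  then show ?thesis using that w by blast
qed

lemma continuous_on_slice:
  assumes "continuous_on (UNIV \<times> S) (\<lambda>(x, t). u x t)" "t \<in> S"
  shows "continuous_on UNIV (\<lambda>x. u x t)"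
proof -
  have "continuous_on UNIV (\<lambda>x. (x, t))" by (intro continuous_on_Pair continuous_on_id continuous_on_const)
  then show ?thesis using continuous_on_compose2[OF assms(1), of UNIV "\<lambda>x. (x, t)"] assms(2) by auto
qed

text \<open>By compactness of the unit ball, the functions of \<open>w\<close> under the infimum are
  uniformly close for nearby \<open>z\<close>; evaluating each at the minimiser of the other
  compares the minima.\<close>

lemma continuous_on_ball_min:
  fixes u :: "'a::euclidean_space \<Rightarrow> real \<Rightarrow> real"
  assumes uc: "continuous_on (UNIV \<times> S) (\<lambda>(x, t). u x t)" and \<rho>: "continuous_on S \<rho>" and m: "continuous_on S m"
  shows "continuous_on (UNIV \<times> S) (\<lambda>(x, t). ball_min \<rho> m u x t)"
proof -
  let ?U = "(UNIV :: 'a set) \<times> S"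
  let ?f = "\<lambda>(z, w). u (fst z + \<rho> (snd z) *\<^sub>R w) (snd z)"
  let ?I = "\<lambda>z. Inf ((\<lambda>w. u (fst z + \<rho> (snd z) *\<^sub>R w) (snd z)) ` cball 0 1)"
  have \<rho>2: "continuous_on (?U \<times> cball (0::'a) 1) (\<lambda>p. \<rho> (snd (fst p)))"
    by (rule continuous_on_compose2[OF \<rho>]) (auto intro!: continuous_intros)
  have fc: "continuous_on (?U \<times> cball 0 1) ?f"
    using continuous_on_compose2[OF uc, of "?U \<times> cball 0 1" "\<lambda>p. (fst (fst p) + \<rho> (snd (fst p)) *\<^sub>R snd p, snd (fst p))"] \<rho>2
    by (force simp: case_prod_unfold intro!: continuous_intros)
  have m2: "continuous_on ?U (\<lambda>z. m (snd z))"
    by (rule continuous_on_compose2[OF m]) (auto intro!: continuous_intros)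
  have att: "\<exists>w. norm w \<le> 1 \<and> ?I z = ?f (z, w) \<and> (\<forall>w'. norm w' \<le> 1 \<longrightarrow> ?I z \<le> ?f (z, w'))" if "z \<in> ?U" for z
  proof -
    have "continuous_on UNIV (\<lambda>x. u x (snd z))" using continuous_on_slice[OF uc] that by auto
    then obtain w where "norm w \<le> 1" "ball_min \<rho> (\<lambda>_. 0) u (fst z) (snd z) = u (fst z + \<rho> (snd z) *\<^sub>R w) (snd z) + 0"
      "\<And>w'. norm w' \<le> 1 \<Longrightarrow> u (fst z + \<rho> (snd z) *\<^sub>R w) (snd z) \<le> u (fst z + \<rho> (snd z) *\<^sub>R w') (snd z)"
      using ball_min_attained[of u "snd z" \<rho> "\<lambda>_. 0" "fst z"] by metis
    then show ?thesis unfolding ball_min_def by auto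
  qed
  have "continuous_on ?U ?I"
  proof (rule continuous_on_iff[THEN iffD2], intro ballI allI impI)
    fix z and e :: real assume z: "z \<in> ?U" and e: "e > 0"
    obtain X where X: "z \<in> X" "open X" "\<forall>y\<in>X \<inter> ?U. \<forall>w\<in>cball 0 1. dist (?f (y, w)) (?f (z, w)) \<le> e / 2"
      using continuous_on_prod_compactE[OF fc compact_cball z, of "e / 2"] e by auto
    obtain d where d: "d > 0" "\<And>y. dist y z < d \<Longrightarrow> y \<in> X" using X(1,2) unfolding open_dist by blast
    have "dist (?I y) (?I z) < e" if y: "y \<in> ?U" "dist y z < d" for y
    proof -
      have close: "\<bar>?f (y, w) - ?f (z, w)\<bar> \<le> e / 2" if "norm w \<le> 1" for w
        using X(3) d(2)[OF y(2)] y(1) that by (simp add: dist_real_def)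
      obtain w1 where w1: "norm w1 \<le> 1" "?I y = ?f (y, w1)" "\<And>w'. norm w' \<le> 1 \<Longrightarrow> ?I y \<le> ?f (y, w')"
        using att[OF y(1)] by blast
      obtain w2 where w2: "norm w2 \<le> 1" "?I z = ?f (z, w2)" "\<And>w'. norm w' \<le> 1 \<Longrightarrow> ?I z \<le> ?f (z, w')"
        using att[OF z] by blast
      have "\<bar>?I y - ?I z\<bar> \<le> e / 2"
        using close[OF w1(1)] close[OF w2(1)] w1(2) w2(2) w1(3)[OF w2(1)] w2(3)[OF w1(1)] by linarith
      then show ?thesis using e by (simp add: dist_real_def)
    qed
    then show "\<exists>d>0. \<forall>x'\<in>?U. dist x' z < d \<longrightarrow> dist (?I x') (?I z) < e" using d(1) by blast
  qed
  then show ?thesis unfolding ball_min_def case_prod_unfold by (intro continuous_intros m2)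
qed

text \<open>This is where convexity enters. Let \<open>a\<close> be a subgradient of \<open>H x t (M x t)\<close> at the test gradient,
  \<open>M\<close> being the ball minimum. At a minimiser \<open>y\<close> of the ball, (H1) only bounds \<open>H y t (u y t)\<close> from below by an
  affine function minus \<open>C1 * \<rho> t * norm q\<close>; the sandwich lemma replaces this by an affine minorant with slope \<open>b\<close>,
  \<open>norm (b - a) \<le> C1 * \<rho> t\<close>. Moving the minimisers with velocity \<open>b\<close> keeps them in the ball, whose radius grows
  faster than \<open>C1 * \<rho> t\<close>.\<close>

lemma subsolution_ball_min:
  fixes u :: "'a::euclidean_space \<Rightarrow> real \<Rightarrow> real"
  assumes Hcont: "continuous_on (UNIV \<times> {0..T} \<times> UNIV \<times> UNIV) (\<lambda>(x, t, v, p). H x t v p)"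
    and H1: "C1 \<ge> 0" "\<beta> \<ge> 0"
      "\<And>x y t v p. t \<in> {0..T} \<Longrightarrow> \<bar>H x t v p - H y t v p\<bar> \<le> C1 * (\<beta> + norm p) * dist x y"
    and H2: "A2 \<ge> 0" "B2 \<ge> 0"
      "\<And>x t v p q. t \<in> {0..T} \<Longrightarrow> \<bar>H x t v p - H x t v q\<bar> \<le> (A2 * norm x + B2) * dist p q"
    and H3: "K3 \<ge> 0"
      "\<And>x t v w p. t \<in> {0..T} \<Longrightarrow> \<bar>H x t v p - H x t w p\<bar> \<le> K3 * \<bar>v - w\<bar>"
    and H4: "\<And>x t v. t \<in> {0..T} \<Longrightarrow> convex_on UNIV (\<lambda>p. H x t v p)"
    and sub: "subsolution T H u" and uc: "continuous_on (UNIV \<times> {0..<T}) (\<lambda>(x, t). u x t)"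
    and N: "N \<ge> 0" and Lip: "\<And>x y t. 0 \<le> t \<Longrightarrow> t < T \<Longrightarrow> \<bar>u x t - u y t\<bar> \<le> N * dist x y"
    and \<rho>: "\<And>t. \<rho> t > 0" "\<And>s t. s \<le> t \<Longrightarrow> \<rho> s \<le> \<rho> t" "\<And>t. (\<rho> has_real_derivative \<rho>' t) (at t)" "\<And>t. \<rho>' t > C1 * \<rho> t"
    and m: "\<And>t. (m has_real_derivative m' t) (at t)"
      "\<And>t. 0 < t \<Longrightarrow> t < T \<Longrightarrow> m t \<ge> 0" "\<And>t. 0 < t \<Longrightarrow> t < T \<Longrightarrow> m' t + K3 * m t + C1 * \<beta> * \<rho> t \<le> 0"
  shows "subsolution T H (ball_min \<rho> m u)"
  unfolding subsolution_def
proof (intro allI impI)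
  fix \<phi> g x t
  let ?M = "ball_min \<rho> m u"
  assume \<phi>: "C1_on UNIV \<phi> g" and t: "0 < t" "t < T"
    and "\<exists>e>0. \<forall>y s. 0 < s \<and> s < T \<and> dist (y, s) (x, t) < e \<longrightarrow> ?M y s - \<phi> (y, s) \<le> ?M x t - \<phi> (x, t)"
  then obtain e where e: "e > 0"
    "\<And>y s. 0 < s \<Longrightarrow> s < T \<Longrightarrow> dist (y, s) (x, t) < e \<Longrightarrow> ?M y s - \<phi> (y, s) \<le> ?M x t - \<phi> (x, t)" by blast
  define p where "p = fst (g (x, t))"
  define \<tau> where "\<tau> = snd (g (x, t))"
  have tT: "t \<in> {0..T}" using t by simp
  show "snd (g (x, t)) + H x t (?M x t) (fst (g (x, t))) \<le> 0"
  proof (rule ccontr)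
    assume neg: "\<not> snd (g (x, t)) + H x t (?M x t) (fst (g (x, t))) \<le> 0"
    \<comment> \<open>Half of the excess: one \<open>\<delta>\<close> is spent on freezing
      \<open>H\<close> at \<open>(y, t)\<close>, the other keeps the derivative behind
      \<open>d2\<close> positive.\<close>
    define \<delta> where "\<delta> = (\<tau> + H x t (?M x t) p) / 2"
    have \<delta>: "\<delta> > 0" using neg by (simp add: \<delta>_def p_def \<tau>_def)
    have slice: "continuous_on UNIV (\<lambda>x. u x s)" if "0 \<le> s" "s < T" for s
      using continuous_on_slice[OF uc] that by simp
    obtain a where a: "\<And>q. H x t (?M x t) q \<ge> H x t (?M x t) p + a \<bullet> (q - p)"
      using convex_lipschitz_subgradient[OF H4[OF tT, of x "?M x t"], of "A2 * norm x + B2" p] H2(1,2) H2(3)[OF tT]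
      by auto
    \<comment> \<open>Times for looking back along the velocity \<open>a\<close>. The derivative of
      \<open>\<phi>\<close> in direction \<open>(a, 1)\<close> is
      \<open>\<tau> + p \<bullet> a\<close>, while an affine minorant with slope \<open>a\<close>
      lets \<open>u\<close> grow at rate \<open>p \<bullet> a - H x t (?M x t) p\<close>, up to the
      costs charged to \<open>m\<close>. The difference is the excess
      \<open>2 * \<delta>\<close>.\<close>
    define hs where "hs = (\<lambda>n. t / 2 * inverse (real (Suc n)))"
    have hs: "0 < hs n" "hs n \<le> t / 2" for n using t by (auto simp: hs_def field_simps)
    have hs0: "hs \<longlonglongrightarrow> 0"
      unfolding hs_def by (rule tendsto_mult_right_zero[OF LIMSEQ_inverse_real_of_nat])
    have "\<exists>y. dist y (x - hs n *\<^sub>R a) \<le> \<rho> (t - hs n) \<and> ?M (x - hs n *\<^sub>R a) (t - hs n) = u y (t - hs n) + m (t - hs n)" for n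
    proof -
      have "0 \<le> t - hs n" "t - hs n < T" using hs[of n] t by linarith+
      from slice[OF this] show ?thesis
        using ball_min_point[of u "t - hs n" \<rho> "x - hs n *\<^sub>R a" m] \<rho>(1) by metis
    qed
    then obtain ys where ys: "\<And>n. dist (ys n) (x - hs n *\<^sub>R a) \<le> \<rho> (t - hs n)"
      "\<And>n. ?M (x - hs n *\<^sub>R a) (t - hs n) = u (ys n) (t - hs n) + m (t - hs n)" by metis
    have "ys n \<in> cball x (\<rho> t + norm a * t)" for n
    proof -
      have "dist x (ys n) \<le> dist (ys n) (x - hs n *\<^sub>R a) + dist (x - hs n *\<^sub>R a) x"
        by (metis dist_commute dist_triangle)
      also have "dist (x - hs n *\<^sub>R a) x = norm a * hs n" using hs(1)[of n] by (simp add: dist_norm)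
      also have "norm a * hs n \<le> norm a * t" using hs[of n] t by (intro mult_left_mono) auto
      also have "dist (ys n) (x - hs n *\<^sub>R a) \<le> \<rho> t" using ys(1)[of n] \<rho>(2)[of "t - hs n" t] hs(1)[of n] by simp
      finally show ?thesis by simp
    qed
    then obtain y r where y: "strict_mono r" "(ys \<circ> r) \<longlonglongrightarrow> y"
      using compact_cball[of x "\<rho> t + norm a * t"] unfolding compact_def by metis
    define h where "h = hs \<circ> r"
    define Y where "Y = ys \<circ> r"
    have Y: "Y \<longlonglongrightarrow> y" "\<And>n. dist (Y n) (x - h n *\<^sub>R a) \<le> \<rho> (t - h n)"
      "\<And>n. ?M (x - h n *\<^sub>R a) (t - h n) = u (Y n) (t - h n) + m (t - h n)"
      using y(2) ys by (auto simp: Y_def h_def)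
    have h: "h \<longlonglongrightarrow> 0" "\<And>n. 0 < h n" "\<And>n. h n \<le> t / 2"
      using LIMSEQ_subseq_LIMSEQ[OF hs0 y(1)] hs by (auto simp: h_def)
    have th: "(\<lambda>n. t - h n) \<longlonglongrightarrow> t" using tendsto_diff[OF tendsto_const h(1), of t] by simp
    have xh: "(\<lambda>n. x - h n *\<^sub>R a) \<longlonglongrightarrow> x"
      using tendsto_diff[OF tendsto_const tendsto_scaleR[OF h(1) tendsto_const], of x a] by simp
    have thT: "0 \<le> t - h n" "t - h n < T" "0 < t - h n" for n using h(2,3)[of n] t by auto
    have \<rho>c: "continuous_on S \<rho>" and mc: "continuous_on S m" for S
      using \<rho>(3) m(1) by (meson DERIV_continuous continuous_at_imp_continuous_on)+
    have "(\<lambda>n. ?M (x - h n *\<^sub>R a) (t - h n)) \<longlonglongrightarrow> ?M x t"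
      using continuous_on_tendsto_compose[OF continuous_on_ball_min[OF uc \<rho>c mc] tendsto_Pair[OF xh th]] t thT
      by simp
    moreover have "(\<lambda>n. ?M (x - h n *\<^sub>R a) (t - h n)) \<longlonglongrightarrow> u y t + m t"
      unfolding Y(3)
    proof (rule tendsto_add)
      show "(\<lambda>n. u (Y n) (t - h n)) \<longlonglongrightarrow> u y t"
        using continuous_on_tendsto_compose[OF uc tendsto_Pair[OF Y(1) th]] t thT by simp
      show "(\<lambda>n. m (t - h n)) \<longlonglongrightarrow> m t"
        using continuous_on_tendsto_compose[OF mc[of UNIV] th] by simp
    qed
    ultimately have My: "?M x t = u y t + m t" by (rule LIMSEQ_unique)
    have yx: "dist y x \<le> \<rho> t"
    proof (rule LIMSEQ_le_const2[OF tendsto_dist[OF Y(1) xh]])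
      show "\<exists>N. \<forall>n\<ge>N. dist (Y n) (x - h n *\<^sub>R a) \<le> \<rho> t"
        using Y(2) \<rho>(2)[of "t - h _" t] h(2) by (meson diff_le_eq le_add_same_cancel1 less_imp_le order_trans)
    qed
    \<comment> \<open>The minorant at \<open>x\<close> loses two constants on transfer to
      \<open>y\<close>: one by \<open>H1\<close> with \<open>dist y x \<le> \<rho> t\<close>, one by
      \<open>H3\<close> with \<open>?M x t - u y t = m t\<close>, where \<open>m t \<ge> 0\<close>
      enters.\<close>
    define c0 where "c0 = H x t (?M x t) p - a \<bullet> p - C1 * \<beta> * \<rho> t - K3 * m t"
    have "H y t (u y t) q \<ge> c0 + a \<bullet> q - C1 * \<rho> t * norm q" for q
    proof -
      have "C1 * (\<beta> + norm q) * dist x y \<le> C1 * (\<beta> + norm q) * \<rho> t"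
        using yx H1(1,2) by (intro mult_left_mono) (auto simp: dist_commute)
      moreover have "\<bar>?M x t - u y t\<bar> = m t" using My m(2)[OF t] by simp
      ultimately show ?thesis
        using a[of q] H1(3)[OF tT, of x "?M x t" q y] H3(2)[OF tT, of y "?M x t" q "u y t"]
        by (simp add: c0_def algebra_simps abs_le_iff)
    qed
    then obtain b where b: "norm (b - a) \<le> C1 * \<rho> t" "\<And>q. H y t (u y t) q \<ge> c0 + b \<bullet> q"
      using affine_sandwich[OF H4[OF tT, of y "u y t"], of "C1 * \<rho> t" c0 a] H1(1) \<rho>(1)[of t] by auto
    define c where "c = \<delta> - c0"
    obtain \<eta> where \<eta>: "\<eta> > 0" "\<And>z s q. 0 < s \<Longrightarrow> s < T \<Longrightarrow> dist (z, s) (y, t) < \<eta> \<Longrightarrow> norm q \<le> 2 * N \<Longrightarrow>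
        H z s (u z s) q \<ge> b \<bullet> q - c"
    proof -
      let ?U = "(UNIV :: 'a set) \<times> {0<..<T}"
      let ?f = "\<lambda>(z, q). H (fst z) (snd z) (u (fst z) (snd z)) q"
      have "continuous_on (?U \<times> cball (0::'a) (2 * N)) (\<lambda>p. (\<lambda>(x, t). u x t) (fst p))"
        by (rule continuous_on_compose2[OF uc]) (auto intro!: continuous_intros)
      then have u2: "continuous_on (?U \<times> cball (0::'a) (2 * N)) (\<lambda>p. u (fst (fst p)) (snd (fst p)))"
        by (simp add: case_prod_unfold)
      have fc: "continuous_on (?U \<times> cball 0 (2 * N)) ?f"
        unfolding case_prod_unfold
        by (intro continuous_on_Hamiltonian[OF Hcont] u2 continuous_intros) auto
      obtain X where X: "(y, t) \<in> X" "open X" "\<forall>z\<in>X \<inter> ?U. \<forall>q\<in>cball 0 (2 * N). dist (?f (z, q)) (?f ((y, t), q)) \<le> \<delta>"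
        using continuous_on_prod_compactE[OF fc compact_cball, of "(y, t)" \<delta>] \<delta> t by auto
      obtain d where d: "d > 0" "\<And>z. dist z (y, t) < d \<Longrightarrow> z \<in> X" using X(1,2) unfolding open_dist by blast
      show ?thesis
      proof (rule that[OF d(1)])
        fix z s and q :: 'a assume z: "0 < s" "s < T" "dist (z, s) (y, t) < d" "norm q \<le> 2 * N"
        have "(z, s) \<in> X \<inter> ?U" "q \<in> cball 0 (2 * N)" using z d(2)[OF z(3)] by auto
        then have "dist (?f ((z, s), q)) (?f ((y, t), q)) \<le> \<delta>"
          using X(3) by blast
        then show "H z s (u z s) q \<ge> b \<bullet> q - c" using b(2)[of q] by (simp add: c_def dist_real_def abs_le_iff)
      qed
    qed
    \<comment> \<open>Lines of velocity \<open>b\<close> started close to \<open>y\<close> must stay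
      in the \<open>\<eta>\<close>-neighbourhood until \<open>t + \<zeta>\<close>, since
      \<open>line_decrease\<close> needs time beyond \<open>t\<close>.\<close>
    define \<zeta> where "\<zeta> = min (\<eta> / (8 * (norm b + 1))) ((T - t) / 2)"
    have nb: "norm b + 1 > 0" by (simp add: add_nonneg_pos)
    have \<zeta>: "\<zeta> > 0" "t + \<zeta> < T" using \<eta>(1) t nb by (auto simp: \<zeta>_def min_def field_simps)
    have \<zeta>b: "\<zeta> * (norm b + 1) \<le> \<eta> / 8"
    proof -
      have "\<zeta> * (norm b + 1) \<le> \<eta> / (8 * (norm b + 1)) * (norm b + 1)"
        using nb by (intro mult_right_mono) (auto simp: \<zeta>_def)
      also have "\<dots> = \<eta> / 8" using nb by (metis divide_divide_eq_left less_irrefl nonzero_eq_divide_eq)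
      finally show ?thesis .
    qed
    have \<zeta>b': "\<zeta> * norm b \<le> \<eta> / 8" "\<zeta> \<le> \<eta> / 8"
      using \<zeta>b \<zeta>(1) by (auto simp: distrib_left) (smt (verit) mult_nonneg_nonneg norm_ge_zero)+
    have step: "u (Y n + h n *\<^sub>R b) t \<le> u (Y n) (t - h n) + c * h n" if n: "dist (Y n) y < \<eta> / 4" "h n < \<zeta>" for n
    proof -
      have "u (Y n + (t - (t - h n)) *\<^sub>R b) t \<le> u (Y n) (t - h n) + c * (t - (t - h n))"
      proof (rule line_decrease[where \<eta> = "\<eta> / 4", OF sub uc N Lip thT(1) _ _ \<zeta>(2)])
        fix s z and q :: 'a
        assume s: "t - h n \<le> s" "s \<le> t + \<zeta>" "dist z (Y n + (s - (t - h n)) *\<^sub>R b) < \<eta> / 4" "norm q \<le> 2 * N"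
        have "dist (Y n + (s - (t - h n)) *\<^sub>R b) (Y n) = (s - (t - h n)) * norm b" using s by (simp add: dist_norm)
        also have "\<dots> \<le> (2 * \<zeta>) * norm b" using s n by (intro mult_right_mono) auto
        also have "\<dots> \<le> \<eta> / 4" using \<zeta>b' by simp
        finally have "dist z y < 3 * \<eta> / 4"
          using s(3) n(1) dist_triangle[of z y "Y n + (s - (t - h n)) *\<^sub>R b"] dist_triangle[of "Y n + (s - (t - h n)) *\<^sub>R b" y "Y n"]
          by linarith
        moreover have "dist s t \<le> \<eta> / 8" unfolding dist_real_def using s(1,2) n(2) \<zeta>b'(2) by linarith
        moreover have "dist (z, s) (y, t) \<le> dist z y + dist s t"
          unfolding dist_prod_def using sqrt_sum_squares_le_sum[of "dist z y" "dist s t"] by simp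
        ultimately have "dist (z, s) (y, t) < \<eta>" using \<eta>(1) by linarith
        then show "b \<bullet> q - c \<le> H z s (u z s) q"
          using s thT(3)[of n] \<zeta> by (intro \<eta>(2)) auto
      qed (use \<eta>(1) \<zeta> h(2)[of n] in auto)
      then show ?thesis by simp
    qed
    obtain d1 where d1: "d1 > 0" "\<And>k. k > 0 \<Longrightarrow> k < d1 \<Longrightarrow> \<rho> (t - k) + C1 * \<rho> t * k < \<rho> t"
    proof -
      have "((\<lambda>s. \<rho> s - C1 * \<rho> t * s) has_real_derivative \<rho>' t - C1 * \<rho> t) (at t)"
        by (auto intro!: derivative_eq_intros \<rho>(3))
      from DERIV_pos_inc_left[OF this] \<rho>(4)[of t] obtain d where "d > 0"
        "\<And>k. k > 0 \<Longrightarrow> k < d \<Longrightarrow> \<rho> (t - k) - C1 * \<rho> t * (t - k) < \<rho> t - C1 * \<rho> t * t" by auto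
      then show ?thesis using that[of d] by (simp add: algebra_simps)
    qed
    \<comment> \<open>Along \<open>(a, 1)\<close> the function \<open>\<phi> - m - c * s\<close> has
      positive derivative, so a short step back lowers it. Together with \<open>step\<close>, this
      contradicts the local maximum of \<open>?M - \<phi>\<close>.\<close>
    obtain d2 where d2: "d2 > 0" "\<And>k. k > 0 \<Longrightarrow> k < d2 \<Longrightarrow> \<phi> (x - k *\<^sub>R a, t - k) - m (t - k) + c * k < \<phi> (x, t) - m t"
    proof -
      have "(\<phi> has_derivative (\<lambda>h. g (x, t) \<bullet> h)) (at (x + (t - t) *\<^sub>R a, t))" using \<phi> by (auto simp: C1_on_def)
      moreover have "((\<lambda>s. (x + (s - t) *\<^sub>R a, s)) has_derivative (\<lambda>s. (s *\<^sub>R a, s))) (at t)"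
        by (auto intro!: derivative_eq_intros)
      ultimately have "((\<lambda>s. \<phi> (x + (s - t) *\<^sub>R a, s)) has_derivative (\<lambda>s. g (x, t) \<bullet> (s *\<^sub>R a, s))) (at t)"
        by (rule has_derivative_compose[rotated])
      then have "((\<lambda>s. \<phi> (x + (s - t) *\<^sub>R a, s)) has_real_derivative (p \<bullet> a + \<tau>)) (at t)"
        unfolding has_field_derivative_def
        by (rule has_derivative_eq_rhs) (auto simp: fun_eq_iff inner_prod_def p_def \<tau>_def algebra_simps)
      then have "((\<lambda>s. \<phi> (x + (s - t) *\<^sub>R a, s) - m s - c * s) has_real_derivative (p \<bullet> a + \<tau>) - m' t - c) (at t)"
        by (auto intro!: derivative_eq_intros m(1))
      moreover have "(p \<bullet> a + \<tau>) - m' t - c > 0"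
      proof -
        have "\<tau> + H x t (?M x t) p = 2 * \<delta>" by (simp add: \<delta>_def)
        then show ?thesis using m(3)[OF t] \<delta> by (simp add: c_def c0_def inner_commute)
      qed
      ultimately obtain d where "d > 0" "\<And>k. k > 0 \<Longrightarrow> k < d \<Longrightarrow>
          \<phi> (x + (t - k - t) *\<^sub>R a, t - k) - m (t - k) - c * (t - k) < \<phi> (x + (t - t) *\<^sub>R a, t) - m t - c * t"
        using DERIV_pos_inc_left by blast
      then show ?thesis using that[of d] by (simp add: algebra_simps)
    qed
    have "\<forall>\<^sub>F n in sequentially. dist (Y n) y < \<eta> / 4"
      using tendstoD[OF Y(1), of "\<eta> / 4"] \<eta>(1) by simp
    moreover have "\<forall>\<^sub>F n in sequentially. h n < min \<zeta> (min d1 d2)"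
      by (rule order_tendstoD(2)[OF h(1)]) (use \<zeta>(1) d1(1) d2(1) in simp)
    moreover have "\<forall>\<^sub>F n in sequentially. dist (x - h n *\<^sub>R a, t - h n) (x, t) < e"
      using tendstoD[OF tendsto_Pair[OF xh th] e(1)] .
    ultimately have "\<forall>\<^sub>F n in sequentially. False"
    proof eventually_elim
      case (elim n)
      have "dist (Y n + h n *\<^sub>R b) x \<le> \<rho> t"
      proof -
        have eq: "Y n + h n *\<^sub>R b - x = (Y n - (x - h n *\<^sub>R a)) + h n *\<^sub>R (b - a)" by (simp add: algebra_simps)
        have "dist (Y n + h n *\<^sub>R b) x \<le> dist (Y n) (x - h n *\<^sub>R a) + h n * norm (b - a)"
          unfolding dist_norm eq using norm_triangle_ineq[of "Y n - (x - h n *\<^sub>R a)" "h n *\<^sub>R (b - a)"] h(2)[of n] by simp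
        also have "h n * norm (b - a) \<le> h n * (C1 * \<rho> t)" using b(1) h(2)[of n] by simp
        finally show ?thesis using Y(2)[of n] d1(2)[OF h(2)[of n]] elim(2) by (simp add: algebra_simps)
      qed
      then have "?M x t \<le> u (Y n + h n *\<^sub>R b) t + m t"
        using ball_min_le[of u t \<rho> "Y n + h n *\<^sub>R b" x m] slice \<rho>(1) t by simp
      also have "u (Y n + h n *\<^sub>R b) t \<le> u (Y n) (t - h n) + c * h n" using elim by (intro step) auto
      finally have "?M x t \<le> ?M (x - h n *\<^sub>R a) (t - h n) - m (t - h n) + m t + c * h n" using Y(3)[of n] by simp
      moreover have "?M (x - h n *\<^sub>R a) (t - h n) - \<phi> (x - h n *\<^sub>R a, t - h n) \<le> ?M x t - \<phi> (x, t)"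
        using elim(3) thT by (intro e(2)) auto
      ultimately show False using d2(2)[OF h(2)[of n]] elim(2) by linarith
    qed
    then show False by simp
  qed
qed

subsection \<open>The lower gradient bound\<close>

text \<open>If the drop stayed below \<open>\<theta> * \<epsilon>\<close>, adding a smoothed cone of
  some slope \<open>\<theta>2 < \<theta>\<close> would move the minimum over the ball into its
  interior, and there the cone supplies a subgradient of norm below \<open>\<theta>\<close>.\<close>

lemma subdiff_bound_imp_descent:
  fixes f :: "'a::euclidean_space \<Rightarrow> real"
  assumes f: "continuous_on UNIV f" and \<theta>: "\<theta> > 0" and \<epsilon>: "\<epsilon> > 0"
    and U: "\<And>y p. dist y x \<le> \<epsilon> \<Longrightarrow> p \<in> subdiff UNIV f y \<Longrightarrow> norm p \<ge> \<theta>"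
  shows "\<exists>y. dist y x \<le> \<epsilon> \<and> f y \<le> f x - \<theta> * \<epsilon>"
proof (rule ccontr)
  assume neg: "\<not> ?thesis"
  obtain y1 where y1: "y1 \<in> cball x \<epsilon>" "\<And>y. y \<in> cball x \<epsilon> \<Longrightarrow> f y1 \<le> f y"
    using continuous_attains_inf[OF compact_cball _ continuous_on_subset[OF f], of x \<epsilon>] \<epsilon> by auto
  define \<theta>1 where "\<theta>1 = max 0 ((f x - f y1) / \<epsilon>)"
  have "f y1 > f x - \<theta> * \<epsilon>" using neg y1(1) by (metis dist_commute mem_cball not_le)
  then have \<theta>1: "\<theta>1 \<ge> 0" "\<theta>1 < \<theta>" using \<theta> \<epsilon> by (auto simp: \<theta>1_def field_simps)
  have "(f x - f y1) / \<epsilon> \<le> \<theta>1" by (simp add: \<theta>1_def)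
  then have "f x - f y1 \<le> \<theta>1 * \<epsilon>" using \<epsilon> by (simp add: field_simps)
  then have low: "f y \<ge> f x - \<theta>1 * \<epsilon>" if "y \<in> cball x \<epsilon>" for y using y1(2)[OF that] by simp
  define \<theta>2 where "\<theta>2 = (\<theta>1 + \<theta>) / 2"
  have \<theta>2: "\<theta>1 < \<theta>2" "\<theta>2 < \<theta>" "\<theta>2 > 0" using \<theta>1 \<theta> by (auto simp: \<theta>2_def)
  \<comment> \<open>Smoothing costs half of \<open>(\<theta>2 - \<theta>1) * \<epsilon>\<close>, the
    margin by which the boundary lies above the centre once the cone is added.\<close>
  define \<nu> where "\<nu> = (\<theta>2 - \<theta>1) * \<epsilon> / (2 * \<theta>2)"
  have \<nu>: "\<nu> > 0" "\<theta>2 * \<nu> = (\<theta>2 - \<theta>1) * \<epsilon> / 2" using \<theta>2 \<epsilon> by (auto simp: \<nu>_def)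
  have C: "C1_on UNIV (\<lambda>y. (- \<theta>2) * smooth_norm \<nu> (y - x))
      (\<lambda>y. (- \<theta>2) *\<^sub>R smooth_norm_grad \<nu> (y - x) + smooth_norm \<nu> (y - x) *\<^sub>R 0)"
    using \<nu> by (intro C1_on_mult C1_on_const C1_on_smooth_norm) auto
  have "continuous_on (cball x \<epsilon>) (\<lambda>y. f y - (- \<theta>2) * smooth_norm \<nu> (y - x))"
    using continuous_on_subset[OF f] continuous_on_subset[OF C1_on_imp_continuous[OF C]]
    by (intro continuous_on_diff) auto
  then have "\<exists>y\<in>cball x \<epsilon>. \<forall>z\<in>cball x \<epsilon>. f y - (- \<theta>2) * smooth_norm \<nu> (y - x) \<le> f z - (- \<theta>2) * smooth_norm \<nu> (z - x)"
    using \<epsilon> by (intro continuous_attains_inf) auto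
  then obtain y where y: "y \<in> cball x \<epsilon>"
    "\<And>z. z \<in> cball x \<epsilon> \<Longrightarrow> f y - (- \<theta>2) * smooth_norm \<nu> (y - x) \<le> f z - (- \<theta>2) * smooth_norm \<nu> (z - x)"
    by blast
  have "dist y x < \<epsilon>"
  proof (rule ccontr)
    assume "\<not> dist y x < \<epsilon>"
    then have "norm (y - x) = \<epsilon>" using y(1) by (simp add: dist_norm norm_minus_commute)
    then have "\<theta>2 * \<epsilon> \<le> \<theta>2 * smooth_norm \<nu> (y - x)" using norm_le_smooth_norm[of "y - x" \<nu>] \<theta>2 by simp
    moreover have "smooth_norm \<nu> (x - x) = \<nu>" using \<nu> by (simp add: smooth_norm_def)
    then have "f y + \<theta>2 * smooth_norm \<nu> (y - x) \<le> f x + \<theta>2 * \<nu>" using y(2)[of x] \<epsilon> by simp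
    moreover have "(\<theta>2 - \<theta>1) * \<epsilon> > 0" using \<theta>2 \<epsilon> by simp
    ultimately show False using low[OF y(1)] \<nu>(2) unfolding left_diff_distrib by argo
  qed
  moreover have "f y - (- \<theta>2) * smooth_norm \<nu> (y - x) \<le> f z - (- \<theta>2) * smooth_norm \<nu> (z - x)"
    if "dist z y < \<epsilon> - dist y x" for z
    using that dist_triangle[of z x y] by (intro y(2)) (simp add: dist_commute)
  ultimately have "\<exists>e>0. \<forall>z\<in>UNIV. dist z y < e \<longrightarrow>
      f y - (- \<theta>2) * smooth_norm \<nu> (y - x) \<le> f z - (- \<theta>2) * smooth_norm \<nu> (z - x)"
    by (intro exI[of _ "\<epsilon> - dist y x"]) auto
  then have "(- \<theta>2) *\<^sub>R smooth_norm_grad \<nu> (y - x) + smooth_norm \<nu> (y - x) *\<^sub>R 0 \<in> subdiff UNIV f y"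
    unfolding subdiff_def
    by (intro CollectI exI[of _ "\<lambda>y. (- \<theta>2) * smooth_norm \<nu> (y - x)"]
        exI[of _ "\<lambda>y. (- \<theta>2) *\<^sub>R smooth_norm_grad \<nu> (y - x) + smooth_norm \<nu> (y - x) *\<^sub>R 0"] conjI refl C)
  then have "norm ((- \<theta>2) *\<^sub>R smooth_norm_grad \<nu> (y - x)) \<ge> \<theta>"
    using U[of y "(- \<theta>2) *\<^sub>R smooth_norm_grad \<nu> (y - x)"] y(1) by (simp add: dist_commute)
  moreover have "\<theta>2 * norm (smooth_norm_grad \<nu> (y - x)) \<le> \<theta>2 * 1"
    using norm_smooth_norm_grad[of \<nu> "y - x"] \<nu> \<theta>2 by (intro mult_left_mono) auto
  ultimately show False using \<theta>2 by simp
qed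

text \<open>On the slice of fixed time \<open>t\<close> the component \<open>\<tau>\<close> drops
  out, and the expansion of the test function together with Cauchy-Schwarz leaves a downward cone of
  slope \<open>norm p + c\<close>.\<close>

lemma subdiff_x_lower_expansion:
  assumes p: "p \<in> subdiff_x T u x t" and t: "0 < t" "t < T" and c: "c > 0"
  shows "\<exists>d>0. \<forall>y. dist y x < d \<longrightarrow> u y t \<ge> u x t - (norm p + c) * dist y x"
proof -
  obtain \<tau> where "(p, \<tau>) \<in> subdiff (UNIV \<times> {0<..<T}) (\<lambda>(y, s). u y s) (x, t)"
    using p unfolding subdiff_x_def by blast
  then obtain \<phi> g where g: "(p, \<tau>) = g (x, t)" "C1_on (UNIV \<times> {0<..<T}) \<phi> g"
    and "\<exists>e>0. \<forall>z\<in>UNIV \<times> {0<..<T}. dist z (x, t) < e \<longrightarrow>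
      (\<lambda>(y, s). u y s) (x, t) - \<phi> (x, t) \<le> (\<lambda>(y, s). u y s) z - \<phi> z"
    unfolding subdiff_def by blast
  then obtain e where e0: "e > 0"
    and e: "\<And>y s. 0 < s \<Longrightarrow> s < T \<Longrightarrow> dist (y, s) (x, t) < e \<Longrightarrow> u x t - \<phi> (x, t) \<le> u y s - \<phi> (y, s)"
    by auto
  have "(x, t) \<in> UNIV \<times> {0<..<T}" using t by simp
  then have "(\<phi> has_derivative (\<lambda>h. (p, \<tau>) \<bullet> h)) (at (x, t))"
    using g unfolding C1_on_def by metis
  then obtain d where d: "d > 0"
    "\<And>z. norm (z - (x, t)) < d \<Longrightarrow> norm (\<phi> z - \<phi> (x, t) - (p, \<tau>) \<bullet> (z - (x, t))) \<le> c * norm (z - (x, t))"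
    using c unfolding has_derivative_at_alt by blast
  show ?thesis
  proof (intro exI[of _ "min d e"] conjI allI impI)
    fix y assume y: "dist y x < min d e"
    have 1: "u x t - \<phi> (x, t) \<le> u y t - \<phi> (y, t)" using y t by (intro e) (auto simp: dist_Pair_Pair)
    have "norm (\<phi> (y, t) - \<phi> (x, t) - (p, \<tau>) \<bullet> ((y, t) - (x, t))) \<le> c * norm ((y, t) - (x, t))"
      using y by (intro d(2)) (auto simp: norm_Pair dist_norm)
    then have "\<phi> (y, t) \<ge> \<phi> (x, t) + p \<bullet> (y - x) - c * dist y x"
      by (auto simp: norm_Pair dist_norm inner_prod_def)
    moreover have "p \<bullet> (y - x) \<ge> - (norm p * dist y x)"
      using Cauchy_Schwarz_ineq2[of p "y - x"] by (simp add: dist_norm)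
    ultimately show "u x t - (norm p + c) * dist y x \<le> u y t" using 1 by (simp add: algebra_simps)
  qed (use d e0 in auto)
qed

lemma C1_on_subset: "C1_on S \<phi> g \<Longrightarrow> S' \<subseteq> S \<Longrightarrow> C1_on S' \<phi> g"
  unfolding C1_on_def by (auto intro: continuous_on_subset)

text \<open>The test functions of \<open>subsolution\<close> are differentiable on the whole space,
  a smaller class than in \<open>visc_solution\<close>, so restriction suffices.\<close>

lemma visc_solution_imp_subsolution:
  assumes "visc_solution T H u0 u"
  shows "subsolution T H u"
  using assms C1_on_subset[OF _ subset_UNIV] unfolding visc_solution_def subsolution_def by blast

lemma visc_solution_imp_reflected_subsolution:
  assumes "visc_solution T H u0 u"
  shows "subsolution T (\<lambda>x t v p. - H x t (- v) (- p)) (\<lambda>x t. - u x t)"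
  unfolding subsolution_def
proof (intro allI impI)
  fix \<phi> g x t
  assume C: "C1_on UNIV \<phi> g" and t: "0 < t" "t < T"
    and "\<exists>e>0. \<forall>y s. 0 < s \<and> s < T \<and> dist (y, s) (x, t) < e \<longrightarrow> - u y s - \<phi> (y, s) \<le> - u x t - \<phi> (x, t)"
  then obtain e where "e > 0"
    "\<forall>y s. 0 < s \<and> s < T \<and> dist (y, s) (x, t) < e \<longrightarrow> u x t - - \<phi> (x, t) \<le> u y s - - \<phi> (y, s)" by force
  moreover have "C1_on (UNIV \<times> {0<..<T}) (\<lambda>z. - \<phi> z) (\<lambda>z. - g z)"
    by (rule C1_on_subset[OF C1_on_uminus[OF C] subset_UNIV])
  ultimately have "snd (- g (x, t)) + H x t (u x t) (fst (- g (x, t))) \<ge> 0"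
    using assms t unfolding visc_solution_def by blast
  then show "snd (g (x, t)) + - H x t (- (- u x t)) (- fst (g (x, t))) \<le> 0" by simp
qed

text \<open>The slack \<open>\<kappa>\<close> makes the radius grow strictly faster than at rate \<open>C1\<close>; with
  \<open>\<rho> s = \<epsilon> * exp ((C1 + \<kappa>) * s)\<close> and \<open>m' = - K3 * m - C1 * \<beta> * \<rho>\<close>, \<open>m 0 = \<theta> * \<epsilon>\<close>, the claimed bound is \<open>m / \<rho>\<close>.\<close>

lemma perturbed_gradient_bound:
  fixes T :: real and H :: "real^'n \<Rightarrow> real \<Rightarrow> real \<Rightarrow> real^'n \<Rightarrow> real"
    and u0 :: "real^'n \<Rightarrow> real" and u :: "real^'n \<Rightarrow> real \<Rightarrow> real"
    and C1 \<beta> A2 B2 K3 r \<theta> :: real and x0 :: "real^'n"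
  assumes Hcont: "continuous_on (UNIV \<times> {0..T} \<times> UNIV \<times> UNIV) (\<lambda>(x, t, v, p). H x t v p)"
    and u0_lip: "\<exists>L. L-lipschitz_on UNIV u0"
    and H1: "C1 \<ge> 0" "\<beta> \<in> {0, 1}"
      "\<And>x y t v p. t \<in> {0..T} \<Longrightarrow> \<bar>H x t v p - H y t v p\<bar> \<le> C1 * (\<beta> + norm p) * dist x y"
    and H2: "A2 \<ge> 0" "B2 \<ge> 0"
      "\<And>x t v p q. t \<in> {0..T} \<Longrightarrow> \<bar>H x t v p - H x t v q\<bar> \<le> (A2 * norm x + B2) * dist p q"
    and H3: "K3 \<ge> 0"
      "\<And>x t v w p. t \<in> {0..T} \<Longrightarrow> \<bar>H x t v p - H x t w p\<bar> \<le> K3 * \<bar>v - w\<bar>"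
    and H4: "\<And>x t v. t \<in> {0..T} \<Longrightarrow> convex_on UNIV (\<lambda>p. H x t v p)"
    and U: "\<theta> > 0" "\<And>x p. x \<in> ball x0 r \<Longrightarrow> p \<in> subdiff UNIV u0 x \<Longrightarrow> norm p \<ge> \<theta>"
    and sol: "visc_solution T H u0 u"
    and xt: "(xh, th) \<in> Eset T A2 B2 x0 r" and p: "p \<in> subdiff_x T u xh th" and \<kappa>: "\<kappa> > 0"
  shows "norm p \<ge> \<theta> * exp (- (C1 + K3 + \<kappa>) * th)
    - C1 * \<beta> / (C1 + K3 + \<kappa>) * (1 - exp (- (C1 + K3 + \<kappa>) * th))"
proof (cases "\<theta> - C1 * \<beta> * ((exp ((C1 + K3 + \<kappa>) * th) - 1) / (C1 + K3 + \<kappa>)) > 0")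
  define k where "k = C1 + K3 + \<kappa>"
  \<comment> \<open>Variation of constants: \<open>\<epsilon> * exp (- K3 * s) * Q s\<close> solves
    the equation for \<open>m\<close> with initial value \<open>\<theta> * \<epsilon>\<close>, and
    \<open>G\<close> is the resulting quotient of \<open>m\<close> and \<open>\<rho>\<close> at
    \<open>th\<close>.\<close>
  define Q where "Q = (\<lambda>s. \<theta> - C1 * \<beta> * ((exp (k * s) - 1) / k))"
  define G where "G = \<theta> * exp (- k * th) - C1 * \<beta> / k * (1 - exp (- k * th))"
  have k: "k > 0" using H1 H3 \<kappa> by (simp add: k_def)
  have QG: "exp (- k * th) * Q th = G"
  proof -
    have "exp (- k * th) * exp (k * th) = 1" by (simp flip: exp_add)
    moreover have "exp (- k * th) * Q th = \<theta> * exp (- k * th) - C1 * \<beta> / k * (exp (- k * th) * exp (k * th) - exp (- k * th))"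
      by (simp add: Q_def algebra_simps diff_divide_distrib)
    ultimately show ?thesis by (simp add: G_def)
  qed
  {
    \<comment> \<open>If \<open>Q th \<le> 0\<close>, the claimed bound is nonpositive and hence
      trivial. In the other case \<open>m\<close> is nonnegative up to \<open>th\<close>, as
      \<open>subsolution_ball_min\<close> demands.\<close>
    case False
    then have "Q th \<le> 0" by (simp add: Q_def k_def)
    then have "G \<le> 0" unfolding QG[symmetric] by (simp add: mult_le_0_iff)
    then show ?thesis unfolding G_def k_def using norm_ge_zero[of p] by linarith
  }
  case True
  then have Qth: "Q th > 0" by (simp add: Q_def k_def)
  have \<beta>: "0 \<le> \<beta>" "\<beta> \<le> 1" using H1(2) by auto
  have th: "0 < th" "th < T" and R: "Rfun A2 B2 xh th + dist xh x0 < r" using xt by (auto simp: Eset_def)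
  note sub = visc_solution_imp_subsolution[OF sol] and super = visc_solution_imp_reflected_subsolution[OF sol]
  have uc: "continuous_on (UNIV \<times> {0..<T}) (\<lambda>(x, t). u x t)" and u_init: "\<And>x. u x 0 = u0 x"
    using sol unfolding visc_solution_def by auto
  obtain L0 where L0: "L0-lipschitz_on UNIV u0" using u0_lip by blast
  define L where "L = max 1 L0"
  have u0L: "u0 x - u0 y \<le> L * dist x y" for x y
  proof -
    have "u0 x - u0 y \<le> L0 * dist x y" using lipschitz_onD[OF L0, of x y] by (simp add: dist_real_def)
    also have "\<dots> \<le> L * dist x y" by (intro mult_right_mono) (auto simp: L_def)
    finally show ?thesis .
  qed
  have L: "L \<ge> 1" by (simp add: L_def)
  have H1': "\<bar>H x t v p - H y t v p\<bar> \<le> C1 * (1 + norm p) * dist x y" if "t \<in> {0..T}" for x y t v p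
  proof -
    have "C1 * (\<beta> + norm p) * dist x y \<le> C1 * (1 + norm p) * dist x y"
      using \<beta> H1(1) by (intro mult_right_mono mult_left_mono) auto
    then show ?thesis using H1(3)[OF that, of x v p y] by linarith
  qed
  define N where "N = exp ((K3 + 2 * C1 + 1) * T) * L"
  have N: "N \<ge> 0" using L by (simp add: N_def)
  have Lip1: "u x t - u y t \<le> N * dist x y" if t: "0 \<le> t" "t < T" for x y t
  proof -
    \<comment> \<open>Comparison of \<open>u\<close> with itself. The initial data are Lipschitz
      everywhere, so any large cone will do; \<open>less_add_one\<close> picks its radius.\<close>
    have "u x t - u y t \<le> exp ((K3 + 2 * C1 + 1) * t) * (L * dist x y)"
      by (rule cone_comparison[OF t H2(1,2) Hcont H1(1) H1' H2(3) H3 sub super uc uc less_add_one L])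
        (simp_all add: u_init u0L)
    also have "\<dots> \<le> exp ((K3 + 2 * C1 + 1) * T) * (L * dist x y)"
      using L t H1(1) H3(1) by (intro mult_right_mono) (auto intro!: mult_left_mono)
    finally show ?thesis by (simp add: N_def)
  qed
  have Lip: "\<bar>u x t - u y t\<bar> \<le> N * dist x y" if "0 \<le> t" "t < T" for x y t
    using Lip1[OF that, of x y] Lip1[OF that, of y x] by (simp add: abs_le_iff dist_commute)
  have Qc: "isCont Q s" for s unfolding Q_def using k by (intro continuous_intros) auto
  have Qmono: "Q s \<le> Q s'" if "s' \<le> s" for s s'
    unfolding Q_def using that k H1(1) \<beta> by (intro diff_left_mono mult_left_mono divide_right_mono) auto
  obtain d where d: "d > 0" "\<And>s. dist s th < d \<Longrightarrow> Q s > 0"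
    using order_tendstoD(1)[OF Qc[of th, unfolded isCont_def] Qth] Qth
    unfolding eventually_at by (metis dist_nz UNIV_I dist_self less_irrefl zero_less_dist_iff)
  \<comment> \<open>\<open>m\<close> must be nonnegative on the whole open time interval of the
    subsolution property, and this interval has to contain \<open>th\<close>; hence the cut slightly
    after \<open>th\<close>.\<close>
  define T' where "T' = min T (th + d)"
  have T': "th < T'" "T' \<le> T" using th d by (auto simp: T'_def)
  have Qpos: "Q s > 0" if "s < T'" for s
  proof (cases "s \<le> th")
    case True
    then show ?thesis using Qmono[of s th] Qth by simp
  next
    case False
    then show ?thesis using that by (intro d(2)) (auto simp: T'_def dist_real_def)
  qed
  \<comment> \<open>One third of the gap enlarges the initial ball of the comparison beyond
    \<open>Rfun\<close>, another accommodates the radius \<open>\<epsilon>\<close>; every point at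
    which (U) is used then lies in \<open>ball x0 r\<close>.\<close>
  define gap where "gap = r - Rfun A2 B2 xh th - dist xh x0"
  have gap: "gap > 0" using R by (simp add: gap_def)
  have Rf: "Rfun A2 B2 xh th = (A2 * norm xh + B2) * cone_time A2 th"
    using H2(1) by (auto simp: Rfun_def cone_time_def field_simps)
  have uc': "continuous_on (UNIV \<times> {0..<T'}) (\<lambda>(x, t). u x t)"
    by (rule continuous_on_subset[OF uc]) (use T' in auto)
  have Hcont': "continuous_on (UNIV \<times> {0..T'} \<times> UNIV \<times> UNIV) (\<lambda>(x, t, v, p). H x t v p)"
    by (rule continuous_on_subset[OF Hcont]) (use T' in auto)
  have u0c: "continuous_on UNIV u0" using L0 lipschitz_on_continuous_on by blast
  have key: "\<exists>y. dist y xh \<le> \<epsilon> * exp ((C1 + \<kappa>) * th) \<and> u y th + \<epsilon> * exp ((C1 + \<kappa>) * th) * G \<le> u xh th"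
    if \<epsilon>: "\<epsilon> > 0" "\<epsilon> \<le> gap / 3" for \<epsilon>
  proof -
    define \<rho> where "\<rho> = (\<lambda>s. \<epsilon> * exp ((C1 + \<kappa>) * s))"
    define m where "m = (\<lambda>s. \<epsilon> * exp (- K3 * s) * Q s)"
    have \<rho>: "\<rho> s > 0" "(\<rho> has_real_derivative (C1 + \<kappa>) * \<rho> s) (at s)" "(C1 + \<kappa>) * \<rho> s > C1 * \<rho> s" for s
      using \<epsilon> \<kappa> by (auto simp: \<rho>_def intro!: derivative_eq_intros)
    have \<rho>m: "\<rho> s \<le> \<rho> s'" if "s \<le> s'" for s s'
      using that \<epsilon> \<kappa> H1(1) by (auto simp: \<rho>_def intro!: mult_left_mono)
    have m': "(m has_real_derivative - K3 * m s - C1 * \<beta> * \<rho> s) (at s)" for s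
    proof -
      have "(Q has_real_derivative - (C1 * \<beta> * exp (k * s))) (at s)"
        unfolding Q_def using k by (auto intro!: derivative_eq_intros)
      then have "(m has_real_derivative \<epsilon> * (- K3 * exp (- K3 * s)) * Q s + \<epsilon> * exp (- K3 * s) * - (C1 * \<beta> * exp (k * s))) (at s)"
        unfolding m_def by (auto intro!: derivative_eq_intros)
      moreover have "exp (- K3 * s) * exp (k * s) = exp ((C1 + \<kappa>) * s)"
        by (simp add: k_def algebra_simps flip: exp_add)
      ultimately show ?thesis
        by (simp add: m_def \<rho>_def algebra_simps)
    qed
    have subM: "subsolution T' H (ball_min \<rho> m u)"
    proof (rule subsolution_ball_min[OF Hcont' H1(1) \<beta>(1) H1(3) H2(1,2) H2(3) H3(1) H3(2) H4 subsolution_restrict[OF sub T'(2)] uc' N Lip \<rho>(1) \<rho>m \<rho>(2) \<rho>(3) m'])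
      fix s assume "0 < s" "s < T'"
      then show "0 \<le> m s" using Qpos[of s] \<epsilon> by (simp add: m_def)
    qed (use T' in auto)
    have \<rho>c: "continuous_on S \<rho>" and mc: "continuous_on S m" for S
      using \<rho>(2) m' by (meson DERIV_continuous continuous_at_imp_continuous_on)+
    have slice: "continuous_on UNIV (\<lambda>x. u x s)" if "0 \<le> s" "s < T" for s
      using continuous_on_slice[OF uc] that by simp
    have init: "ball_min \<rho> m u x 0 - u y 0 \<le> L * dist x y" if "dist x xh \<le> Rfun A2 B2 xh th + gap / 3" for x y
    proof -
      have "\<exists>z. dist z x \<le> \<epsilon> \<and> u0 z \<le> u0 x - \<theta> * \<epsilon>"
      proof (rule subdiff_bound_imp_descent[OF u0c U(1) \<epsilon>(1)])
        fix z q assume "dist z x \<le> \<epsilon>" and q: "q \<in> subdiff UNIV u0 z"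
        then have "dist x0 z < r"
          using that \<epsilon>(2) gap dist_triangle[of x0 z x] dist_triangle[of x0 x xh] gap_def
          unfolding dist_commute[of x z] dist_commute[of x0 xh] dist_commute[of xh x] by linarith
        then show "norm q \<ge> \<theta>" using U(2) q by simp
      qed
      then obtain z where z: "dist z x \<le> \<epsilon>" "u0 z \<le> u0 x - \<theta> * \<epsilon>" by blast
      have "ball_min \<rho> m u x 0 \<le> u z 0 + m 0"
        using ball_min_le[of u 0 \<rho> z x m] slice[of 0] th \<rho>(1)[of 0] z(1) by (simp add: \<rho>_def)
      then show ?thesis using z(2) u0L[of x y] by (simp add: u_init m_def Q_def mult.commute)
    qed
    have "ball_min \<rho> m u xh th - u xh th \<le> exp ((K3 + 2 * C1 + 1) * th) * (L * dist xh xh)"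
      by (rule cone_comparison[OF less_imp_le[OF th(1)] T'(1) H2(1,2) Hcont' H1(1) H1' H2(3) H3(1) H3(2) subM
            subsolution_restrict[OF super T'(2)] continuous_on_ball_min[OF uc' \<rho>c mc] uc' _ L init])
        (use T' gap Rf in auto)
    then have "ball_min \<rho> m u xh th \<le> u xh th" by simp
    moreover obtain y where "dist y xh \<le> \<rho> th" "ball_min \<rho> m u xh th = u y th + m th"
      using ball_min_point[of u th \<rho> xh m] slice[of th] th \<rho>(1)[of th] by auto
    moreover have "m th = \<epsilon> * exp ((C1 + \<kappa>) * th) * G"
    proof -
      have "exp (- K3 * th) = exp ((C1 + \<kappa>) * th) * exp (- k * th)"
        by (simp add: k_def algebra_simps flip: exp_add)
      then show ?thesis unfolding m_def QG[symmetric] by simp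
    qed
    ultimately show ?thesis by (auto simp: \<rho>_def)
  qed
  have "G \<le> norm p + c" if c: "c > 0" for c
  proof -
    obtain d where d: "d > 0" "\<And>y. dist y xh < d \<Longrightarrow> u y th \<ge> u xh th - (norm p + c) * dist y xh"
      using subdiff_x_lower_expansion[OF p th c] by blast
    define E where "E = exp ((C1 + \<kappa>) * th)"
    \<comment> \<open>The drop supplied by \<open>key\<close> occurs within distance
      \<open>\<epsilon> * E\<close>, which must be less than \<open>d\<close> for the expansion to
      apply; the factor \<open>\<epsilon> * E\<close> then cancels.\<close>
    define \<epsilon> where "\<epsilon> = min (gap / 3) (d / (2 * E))"
    have E: "E > 0" by (simp add: E_def)
    have \<epsilon>: "\<epsilon> > 0" "\<epsilon> \<le> gap / 3" using gap d E by (auto simp: \<epsilon>_def)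
    have "\<epsilon> * E \<le> d / (2 * E) * E" using E by (intro mult_right_mono) (auto simp: \<epsilon>_def)
    then have \<epsilon>d: "\<epsilon> * E < d" using E d by simp
    obtain y where y: "dist y xh \<le> \<epsilon> * E" "u y th + \<epsilon> * E * G \<le> u xh th"
      using key[OF \<epsilon>] by (auto simp: E_def)
    have "\<epsilon> * E * G \<le> (norm p + c) * dist y xh" using d(2)[of y] y \<epsilon>d by simp
    also have "\<dots> \<le> (norm p + c) * (\<epsilon> * E)" using y(1) c by (intro mult_left_mono) auto
    finally show ?thesis using \<epsilon> E by (simp add: mult.commute)
  qed
  then have "G \<le> norm p" by (rule field_le_epsilon)
  then show ?thesis by (simp add: G_def k_def)
qed

theorem theorem1p5:
  fixes T :: real and H :: "real^'n \<Rightarrow> real \<Rightarrow> real \<Rightarrow> real^'n \<Rightarrow> real"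
    and u0 :: "real^'n \<Rightarrow> real" and u :: "real^'n \<Rightarrow> real \<Rightarrow> real"
    and C1 \<beta> A2 B2 K3 r \<theta> :: real and x0 :: "real^'n"
  assumes T: "T > 0"
    and Hcont: "continuous_on (UNIV \<times> {0..T} \<times> UNIV \<times> UNIV) (\<lambda>(x, t, v, p). H x t v p)"
    and u0_lip: "\<exists>L. L-lipschitz_on UNIV u0"
    and H1: "C1 \<ge> 0" "\<beta> \<in> {0, 1}"
      "\<And>x y t v p. t \<in> {0..T} \<Longrightarrow> \<bar>H x t v p - H y t v p\<bar> \<le> C1 * (\<beta> + norm p) * dist x y"
    and H2: "A2 \<ge> 0" "B2 \<ge> 0"
      "\<And>x t v p q. t \<in> {0..T} \<Longrightarrow> \<bar>H x t v p - H x t v q\<bar> \<le> (A2 * norm x + B2) * dist p q"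
    and H3: "K3 \<ge> 0"
      "\<And>x t v w p. t \<in> {0..T} \<Longrightarrow> \<bar>H x t v p - H x t w p\<bar> \<le> K3 * \<bar>v - w\<bar>"
    and H4: "\<And>x t v. t \<in> {0..T} \<Longrightarrow> convex_on UNIV (\<lambda>p. H x t v p)"
    and r: "r > 0"
    and U: "\<theta> > 0" "\<And>x p. x \<in> ball x0 r \<Longrightarrow> p \<in> subdiff UNIV u0 x \<Longrightarrow> norm p \<ge> \<theta>"
    and sol: "visc_solution T H u0 u"
  shows "((C1, K3) \<noteq> (0, 0) \<longrightarrow>
            (\<forall>(x, t) \<in> Eset T A2 B2 x0 r. \<forall>p \<in> subdiff_x T u x t.
               norm p \<ge> \<theta> * exp (- (C1 + K3) * t)
                        - C1 * \<beta> / (C1 + K3) * (1 - exp (- (C1 + K3) * t))))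
       \<and> ((C1, K3) = (0, 0) \<longrightarrow>
            (\<forall>(x, t) \<in> Eset T A2 B2 x0 r. \<forall>p \<in> subdiff_x T u x t. norm p \<ge> \<theta>))"
proof -
  define f where "f = (\<lambda>t \<kappa>. \<theta> * exp (- (C1 + K3 + \<kappa>) * t)
    - C1 * \<beta> / (C1 + K3 + \<kappa>) * (1 - exp (- (C1 + K3 + \<kappa>) * t)))"
  have bound: "f t \<kappa> \<le> norm p" if "(x, t) \<in> Eset T A2 B2 x0 r" "p \<in> subdiff_x T u x t" "\<kappa> > 0" for x t p \<kappa>
    unfolding f_def using that by (intro perturbed_gradient_bound[OF Hcont u0_lip H1 H2 H3 H4 U sol])
  have limit: "l \<le> norm p" if "(x, t) \<in> Eset T A2 B2 x0 r" "p \<in> subdiff_x T u x t"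
    "(f t \<longlongrightarrow> l) (at_right 0)" for x t p l
    by (rule tendsto_upperbound[OF that(3)])
      (use bound[OF that(1,2)] in \<open>auto simp: eventually_at_filter\<close>)
  show ?thesis
  proof (intro conjI impI)
    assume "(C1, K3) \<noteq> (0, 0)"
    then have "C1 + K3 \<noteq> 0" using H1(1) H3(1) by (auto simp: add_nonneg_eq_0_iff)
    then have "(f t \<longlongrightarrow> \<theta> * exp (- (C1 + K3 + 0) * t)
        - C1 * \<beta> / (C1 + K3 + 0) * (1 - exp (- (C1 + K3 + 0) * t))) (at_right 0)" for t
      unfolding f_def by (intro tendsto_intros) auto
    then show "\<forall>(x, t) \<in> Eset T A2 B2 x0 r. \<forall>p \<in> subdiff_x T u x t.
        norm p \<ge> \<theta> * exp (- (C1 + K3) * t) - C1 * \<beta> / (C1 + K3) * (1 - exp (- (C1 + K3) * t))"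
      using limit by fastforce
  next
    \<comment> \<open>With \<open>C1 = 0\<close> the fraction vanishes for every
      \<open>\<kappa> > 0\<close>, so its denominator may tend to 0 without harm.\<close>
    assume C: "(C1, K3) = (0, 0)"
    have "((\<lambda>\<kappa>. \<theta> * exp (- \<kappa> * t)) \<longlongrightarrow> \<theta> * exp (- 0 * t)) (at_right 0)" for t
      by (intro tendsto_intros)
    then have "(f t \<longlongrightarrow> \<theta>) (at_right 0)" for t using C by (simp add: f_def)
    then show "\<forall>(x, t) \<in> Eset T A2 B2 x0 r. \<forall>p \<in> subdiff_x T u x t. norm p \<ge> \<theta>"
      using limit by fastforce
  qed
qed

end
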